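(* Let $n\ge 1$. The Hilbert series of the dual algebra $ch(P_n)^*$ is $H_n(x)=\sum_{i\ge 0}H_n^i x^i$ with $$H_n^i=\sum_{j\ge 0}M(n,j)\binom{n-2j}{i-j},$$ where $M(n,j)$ is the number of matchings of size $j$ in the path graph on $n$ vertices, and the Hilbert series of $P_n$ is $\dfrac{1}{H_n(-x)}$.
   Context: Fix a ground field $F$; $[m]=\{1,\dots,m\}$ and $[x,y]=xy-yx$. $P_n$ denotes the associative unital $F$-algebra presented by generators $v_1,\dots,v_n,e_{1,2},e_{2,3},\dots,e_{n-1,n}$ and relations: $[v_i,v_j]=0$ for $i,j\in[n]$, $j>i+1$; $[v_i,v_{i+1}]+e_{i,i+1}(v_{i+1}-v_i)=0$ for $i\in[n-1]$; $[e_{i,i+1},e_{j,j+1}]=0$ for $i,j\in[n-1]$, $j>i+1$; $[v_i,e_{j,j+1}]=0$ for $i\in[n]$, $j\in[n-1]$ with $j>i+1$ or $j<i-2$; $[v_i,e_{i+1,i+2}]+e_{i,i+1}e_{i+1,i+2}=0$ for $i\in[n-2]$; $[v_{i+2},e_{i,i+1}]+e_{i+1,i+2}e_{i,i+1}=0$ for $i\in[n-2]$. $ch(P_n)$ denotes the associative unital $F$-algebra with the same generators and relations: all $v_i$ commute with each other, and each $e_{i,i+1}$ commutes with every generator except $e_{i-1,i}$, $e_{i+1,i+2}$, $v_i$, $v_{i+1}$ (no relation is imposed between $e_{i,i+1}$ and these). For a quadratic algebra $A=T(V)/(R)$ with $V$ finite-dimensional and $R\subseteq V\otimes V$, the dual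 algebra is $A^*=T(V^* )/(R^\perp)$, where $R^\perp\subseteq V^*\otimes V^*\cong (V\otimes V)^*$ is the annihilator of $R$. All these algebras are graded with generators in degree $1$, and the Hilbert series of a graded algebra $A=\bigoplus_i A_i$ is $\sum_i \dim(A_i)x^i$. A matching of size $j$ in a graph is a set of $j$ pairwise disjoint edges. $\binom{a}{b}=0$ if $b<0$ or $b>a\geq 0$; terms with $M(n,j)=0$ are read as $0$. *)

theory Defs
  imports
    "HOL-Algebra.Embedded_Algebras"
    "HOL-Algebra.QuotRing"
    "HOL-Library.Poly_Mapping"
    "HOL-Library.Disjoint_Sets"
    "HOL-Computational_Algebra.Formal_Power_Series"
begin

section \<open>Free algebras\<close>

text \<open>Words form a monoid under concatenation.  With this instance, the convolution product of
  \<open>Poly_Mapping\<close> makes \<open>'x list \<Rightarrow>\<^sub>0 'f\<close> the free associative unital algebra over \<open>'f\<close>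
  on all elements of \<open>'x\<close>.\<close>

instantiation list :: (type) monoid_add
begin

definition zero_list :: "'a list" where "zero_list = []"

definition plus_list :: "'a list \<Rightarrow> 'a list \<Rightarrow> 'a list" where "plus_list = (@)"

instance by standard (simp_all add: zero_list_def plus_list_def)

end

type_synonym ('x, 'f) ncpoly = "'x list \<Rightarrow>\<^sub>0 'f"

definition scalar_poly :: "'f::field \<Rightarrow> ('x, 'f) ncpoly"
  where "scalar_poly c = Poly_Mapping.single [] c"

definition var :: "'x \<Rightarrow> ('x, 'f::field) ncpoly"
  where "var x = Poly_Mapping.single [x] 1"

definition free_algebra :: "'x set \<Rightarrow> ('x, 'f::field) ncpoly ring"
  where "free_algebra X =
    \<lparr>carrier = {p. Poly_Mapping.keys p \<subseteq> lists X}, monoid.mult = (\<lambda>p q. p * q), one = 1,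
     ring.zero = 0, add = (\<lambda>p q. p + q)\<rparr>"

definition homogeneous :: "'x set \<Rightarrow> nat \<Rightarrow> ('x, 'f::field) ncpoly set"
  where "homogeneous X i =
    {p. Poly_Mapping.keys p \<subseteq> {w \<in> lists X. length w = i}}"


section \<open>Presented algebras and their Hilbert series\<close>

definition relation_ideal ::
    "'x set \<Rightarrow> ('x, 'f::field) ncpoly set \<Rightarrow> ('x, 'f) ncpoly set"
  where "relation_ideal X R = Idl\<^bsub>free_algebra X\<^esub> R"

definition presented_algebra ::
    "'x set \<Rightarrow> ('x, 'f::field) ncpoly set \<Rightarrow> ('x, 'f) ncpoly set ring"
  where "presented_algebra X R = free_algebra X Quot relation_ideal X R"

definition residue_class ::
    "'x set \<Rightarrow> ('x, 'f::field) ncpoly set \<Rightarrow> ('x, 'f) ncpoly \<Rightarrow> ('x, 'f) ncpoly set"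
  where "residue_class X R p = relation_ideal X R +>\<^bsub>free_algebra X\<^esub> p"

text \<open>The ground field inside the algebra; this is what makes the quotient ring an algebra, in the
  sense of \<open>HOL-Algebra.Embedded_Algebras\<close>.\<close>

definition scalars :: "'x set \<Rightarrow> ('x, 'f::field) ncpoly set \<Rightarrow> ('x, 'f) ncpoly set set"
  where "scalars X R = residue_class X R ` range scalar_poly"

definition graded_component ::
    "'x set \<Rightarrow> ('x, 'f::field) ncpoly set \<Rightarrow> nat \<Rightarrow> ('x, 'f) ncpoly set set"
  where "graded_component X R i = residue_class X R ` homogeneous X i"

definition hilbert_series :: "'x set \<Rightarrow> ('x, 'f::field) ncpoly set \<Rightarrow> rat fps"
  where "hilbert_series X R = Abs_fps (\<lambda>i. of_nat
    ((ring.dim (presented_algebra X R) over scalars X R) (graded_component X R i)))"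


section \<open>Quadratic duals\<close>

text \<open>Here \<open>V\<close> has the finite basis \<open>X\<close>, and \<open>R\<close> spans the space of relations in \<open>V \<otimes> V\<close>.
  The dual basis of \<open>V\<^sup>*\<close> is again indexed by \<open>X\<close>, so \<open>T(V\<^sup>*)\<close> is \<open>free_algebra X\<close> as well, and
  the pairing between \<open>V\<^sup>* \<otimes> V\<^sup>*\<close> and \<open>V \<otimes> V\<close> is the one for which the words of length 2 are
  dual bases.\<close>

definition quadratic_pairing ::
    "'x set \<Rightarrow> ('x, 'f::field) ncpoly \<Rightarrow> ('x, 'f) ncpoly \<Rightarrow> 'f"
  where "quadratic_pairing X q r =
    (\<Sum>x\<in>X. \<Sum>y\<in>X. Poly_Mapping.lookup q [x, y] * Poly_Mapping.lookup r [x, y])"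

definition dual_relations ::
    "'x set \<Rightarrow> ('x, 'f::field) ncpoly set \<Rightarrow> ('x, 'f) ncpoly set"
  where "dual_relations X R =
    {q \<in> homogeneous X 2. \<forall>r\<in>R. quadratic_pairing X q r = 0}"


section \<open>The algebras \<open>P\<^sub>n\<close> and \<open>ch(P\<^sub>n)\<close>\<close>

text \<open>\<open>Vg i\<close> stands for \<open>v\<^sub>i\<close>, and \<open>Eg i\<close> for the generator \<open>e\<close> with indices \<open>i\<close> and \<open>i + 1\<close>.\<close>

datatype gen = Vg nat | Eg nat

definition P_gens :: "nat \<Rightarrow> gen set"
  where "P_gens n = Vg ` {1..n} \<union> Eg ` {1..n - 1}"

abbreviation vv :: "nat \<Rightarrow> (gen, 'f::field) ncpoly" where "vv i \<equiv> var (Vg i)"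

abbreviation ee :: "nat \<Rightarrow> (gen, 'f::field) ncpoly" where "ee i \<equiv> var (Eg i)"

definition commutator :: "'a::ring \<Rightarrow> 'a \<Rightarrow> 'a"
  where "commutator x y = x * y - y * x"

definition P_rels :: "nat \<Rightarrow> (gen, 'f::field) ncpoly set"
  where "P_rels n =
      {commutator (vv i) (vv j) | i j. i \<in> {1..n} \<and> j \<in> {1..n} \<and> j > i + 1}
    \<union> {commutator (vv i) (vv (i + 1)) + ee i * (vv (i + 1) - vv i) | i. i \<in> {1..n - 1}}
    \<union> {commutator (ee i) (ee j) | i j. i \<in> {1..n - 1} \<and> j \<in> {1..n - 1} \<and> j > i + 1}
    \<union> {commutator (vv i) (ee j) | i j. i \<in> {1..n} \<and> j \<in> {1..n - 1} \<and> (j > i + 1 \<or> j + 2 < i)}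
    \<union> {commutator (vv i) (ee (i + 1)) + ee i * ee (i + 1) | i. i \<in> {1..n - 2}}
    \<union> {commutator (vv (i + 2)) (ee i) + ee (i + 1) * ee i | i. i \<in> {1..n - 2}}"

text \<open>For \<open>i = 1\<close> the excluded symbol \<open>Eg (i - 1) = Eg 0\<close> is not a generator.\<close>

definition ch_rels :: "nat \<Rightarrow> (gen, 'f::field) ncpoly set"
  where "ch_rels n =
      {commutator (vv i) (vv j) | i j. i \<in> {1..n} \<and> j \<in> {1..n}}
    \<union> {commutator (ee i) (var g) | i g.
         i \<in> {1..n - 1} \<and> g \<in> P_gens n - {Eg (i - 1), Eg (i + 1), Vg i, Vg (i + 1)}}"


section \<open>Matchings and the series \<open>H\<^sub>n\<close>\<close>

definition path_edges :: "nat \<Rightarrow> nat set set"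
  where "path_edges n = {{i, i + 1} | i. i \<in> {1..n - 1}}"

definition matchings :: "'a set set \<Rightarrow> nat \<Rightarrow> 'a set set set"
  where "matchings Es j = {M. M \<subseteq> Es \<and> card M = j \<and> disjoint M}"

definition num_matchings :: "nat \<Rightarrow> nat \<Rightarrow> nat"
  where "num_matchings n j = card (matchings (path_edges n) j)"

text \<open>For \<open>j > i\<close> the lower entry of the binomial coefficient is negative, so these terms vanish.
  The truncated subtraction \<open>n - 2 * j\<close> differs from the integer one only if \<open>2 * j > n\<close>,
  in which case \<open>num_matchings n j = 0\<close>.\<close>

definition H_coeff :: "nat \<Rightarrow> nat \<Rightarrow> nat"
  where "H_coeff n i = (\<Sum>j\<le>i. num_matchings n j * ((n - 2 * j) choose (i - j)))"

definition H_series :: "nat \<Rightarrow> rat fps"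
  where "H_series n = Abs_fps (\<lambda>i. of_nat (H_coeff n i))"

end

theory Submission
  imports Defs
begin

text \<open>Attach to \<open>v\<^sub>i\<close> the point \<open>i\<close> and to \<open>e\<^sub>i\<^sub>,\<^sub>i\<^sub>+\<^sub>1\<close> the interval from \<open>i\<close> to \<open>i + 1\<close>.  Two generators
  commute in \<open>ch(P\<^sub>n)\<close> exactly if their intervals are disjoint, and then one lies to the left of the
  other; this relation is transitive.  The defining relations of \<open>P\<^sub>n\<close> rewrite \<open>y x\<close>, with \<open>x\<close> to the left
  of \<open>y\<close>, to \<open>x y\<close> plus lexicographically smaller words, and all overlaps \<open>z y x\<close> resolve; hence the words
  without such a factor \<open>y x\<close> form a basis of \<open>P\<^sub>n\<close>.  In the dual of \<open>ch(P\<^sub>n)\<close> the rules are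
  \<open>y x \<rightarrow> - x y\<close>, and \<open>a b \<rightarrow> 0\<close> if \<open>a\<close> and \<open>b\<close> meet, so the words increasing from left to right form
  a basis.  Such a word is a set of disjoint intervals, that is, a matching together with a set of
  vertices it does not cover.  Since the words in the first basis are those avoiding the adjacent pairs
  that make up the (reversed) words in the second one, the two series are related by \<open>A(x) B(-x) = 1\<close>.\<close>


section \<open>Free algebras and linear maps\<close>

abbreviation word :: "'x list \<Rightarrow> ('x, 'f::field) ncpoly"
  where "word w \<equiv> Poly_Mapping.single w 1"

lemma word_mult: "word u * word v = word (u @ v)"
  by (simp add: mult_single plus_list_def)

lemma word_Nil: "word [] = 1"
  by (metis single_one zero_list_def)

lemma scalar_poly_mult: "scalar_poly c * scalar_poly d = scalar_poly (c * d)"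
  by (simp add: scalar_poly_def mult_single plus_list_def)

lemma scalar_poly_mult_single: "scalar_poly c * Poly_Mapping.single w d = Poly_Mapping.single w (c * d)"
  by (simp add: scalar_poly_def mult_single plus_list_def)

lemma lookup_scalar_poly_mult:
  "Poly_Mapping.lookup (scalar_poly c * p) w = c * Poly_Mapping.lookup p w"
proof -
  have "scalar_poly c * p = Poly_Mapping.map ((*) c) p"
    by (simp add: scalar_poly_def mult_map_scale_conv_mult zero_list_def)
  then show ?thesis by (simp add: Poly_Mapping.map.rep_eq when_def)
qed

lemma keys_scalar_poly_mult: "Poly_Mapping.keys (scalar_poly c * p) \<subseteq> Poly_Mapping.keys p"
  by (auto simp: in_keys_iff lookup_scalar_poly_mult)

lemma poly_expansion:
  fixes p :: "('x, 'f::field) ncpoly"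
  shows "p = (\<Sum>w\<in>Poly_Mapping.keys p. scalar_poly (Poly_Mapping.lookup p w) * word w)"
  by (rule poly_mapping_eqI)
     (auto simp: lookup_sum scalar_poly_mult_single lookup_single when_def in_keys_iff)

lemma scalar_poly_add: "scalar_poly (c + d) = scalar_poly c + scalar_poly d"
  by (simp add: scalar_poly_def single_add)

lemma scalar_poly_uminus: "scalar_poly (- c) = - scalar_poly c"
  by (simp add: scalar_poly_def single_uminus)

lemma scalar_poly_0 [simp]: "scalar_poly 0 = 0"
  by (simp add: scalar_poly_def)

lemma scalar_poly_1 [simp]: "scalar_poly 1 = 1"
  by (simp add: scalar_poly_def word_Nil)

text \<open>On monomials this is commutativity of the field; \<open>poly_expansion\<close> carries
  it over to all polynomials.\<close>

lemma scalar_poly_commute: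
  fixes p :: "('x, 'f::field) ncpoly"
  shows "p * scalar_poly c = scalar_poly c * p"
proof -
  let ?t = "\<lambda>w. scalar_poly (Poly_Mapping.lookup p w) * word w"
  have "?t w * scalar_poly c = scalar_poly c * ?t w" for w
    by (simp add: scalar_poly_def mult_single plus_list_def mult.commute)
  then have "(\<Sum>w\<in>Poly_Mapping.keys p. ?t w) * scalar_poly c = scalar_poly c * (\<Sum>w\<in>Poly_Mapping.keys p. ?t w)"
    by (simp only: sum_distrib_left sum_distrib_right)
  then show ?thesis by (simp only: poly_expansion[symmetric])
qed

section \<open>Linear maps and their values on words\<close>

definition lin :: "(('x, 'f::field) ncpoly \<Rightarrow> ('x, 'f) ncpoly) \<Rightarrow> bool"
  where "lin G \<longleftrightarrow> (\<forall>p q. G (p + q) = G p + G q) \<and> (\<forall>c p. G (scalar_poly c * p) = scalar_poly c * G p)"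

lemma lin_add: "lin G \<Longrightarrow> G (p + q) = G p + G q"
  and lin_scale: "lin G \<Longrightarrow> G (scalar_poly c * p) = scalar_poly c * G p"
  by (auto simp: lin_def)

lemma lin_0: "lin G \<Longrightarrow> G 0 = 0"
  using lin_scale[of G 0 0] by simp

lemma lin_uminus: "lin G \<Longrightarrow> G (- p) = - G p"
  using lin_scale[of G "- 1" p] by (simp add: scalar_poly_uminus)

lemma lin_diff: "lin G \<Longrightarrow> G (p - q) = G p - G q"
  using lin_add[of G p "- q"] by (simp add: lin_uminus[of G])

lemma lin_sum: "lin G \<Longrightarrow> G (sum f A) = (\<Sum>a\<in>A. G (f a))"
  by (induction A rule: infinite_finite_induct) (simp_all add: lin_0[of G] lin_add[of G])

lemma lin_expansion:
  "lin G \<Longrightarrow> G p = (\<Sum>w\<in>Poly_Mapping.keys p. scalar_poly (Poly_Mapping.lookup p w) * G (word w))"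
  by (subst poly_expansion[of p]) (simp add: lin_sum[of G] lin_scale[of G])

lemma lin_eqI:
  assumes "lin G" "lin H" "\<And>w. w \<in> Poly_Mapping.keys p \<Longrightarrow> G (word w) = H (word w)"
  shows "G p = H p"
  using assms by (simp add: lin_expansion[of G p] lin_expansion[of H p])

text \<open>Constants are central and slide out of \<open>a * p * b\<close>. In this way the effect
  of a linear map on a rule inside a longer word becomes a linear condition on the rule
  alone.\<close>

lemma lin_sandwich:
  assumes "lin G"
  shows "lin (\<lambda>p. G (a * p * b))"
proof -
  have "a * (scalar_poly c * p) * b = scalar_poly c * (a * p * b)" for c p
    by (metis mult.assoc scalar_poly_commute)
  then show ?thesis using assms by (simp add: lin_def algebra_simps)
qed

definition extend :: "('x list \<Rightarrow> ('x, 'f::field) ncpoly) \<Rightarrow> ('x, 'f) ncpoly \<Rightarrow> ('x, 'f) ncpoly"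
  where "extend f p = (\<Sum>w\<in>Poly_Mapping.keys p. scalar_poly (Poly_Mapping.lookup p w) * f w)"

text \<open>Coefficients off the keys vanish, so the sums for \<open>p\<close>, \<open>q\<close> and
  \<open>p + q\<close> can share one index set.\<close>

lemma extend_superset:
  assumes "finite A" "Poly_Mapping.keys p \<subseteq> A"
  shows "extend f p = (\<Sum>w\<in>A. scalar_poly (Poly_Mapping.lookup p w) * f w)"
  unfolding extend_def using assms by (intro sum.mono_neutral_left) (auto simp: in_keys_iff)

lemma lin_extend:
  fixes f :: "'x list \<Rightarrow> ('x, 'f::field) ncpoly"
  shows "lin (extend f)"
  unfolding lin_def
proof (intro conjI allI)
  fix p q :: "('x, 'f) ncpoly" and c :: 'f
  let ?A = "Poly_Mapping.keys p \<union> Poly_Mapping.keys q"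
  have "Poly_Mapping.keys (p + q) \<subseteq> ?A" by (rule keys_add)
  then show "extend f (p + q) = extend f p + extend f q"
    by (simp add: extend_superset[of ?A] lookup_add scalar_poly_add algebra_simps sum.distrib)
  show "extend f (scalar_poly c * p) = scalar_poly c * extend f p"
    unfolding extend_superset[OF finite_keys keys_scalar_poly_mult]
    by (simp add: lookup_scalar_poly_mult extend_def scalar_poly_mult[symmetric] sum_distrib_left mult.assoc)
qed

lemma extend_word: "extend f (word w) = f w"
  by (simp add: extend_def)

lemma var_eq_word: "var x = word [x]"
  by (simp add: var_def)

lemma keys_mult_append:
  "w \<in> Poly_Mapping.keys (p * q) \<Longrightarrow>
    \<exists>u\<in>Poly_Mapping.keys p. \<exists>v\<in>Poly_Mapping.keys q. w = u @ v"
  using keys_mult[of p q] by (fastforce simp: plus_list_def)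

lemma keys_sandwich:
  assumes "w \<in> Poly_Mapping.keys (word u * p * (word v :: ('x, 'f::field) ncpoly))"
  shows "\<exists>t\<in>Poly_Mapping.keys p. w = u @ t @ v"
proof -
  from keys_mult_append[OF assms] obtain s where "s \<in> Poly_Mapping.keys (word u * p)" "w = s @ v"
    by auto
  with keys_mult_append[of s "word u" p] show ?thesis by auto
qed

section \<open>The free algebra as a ring containing the field\<close>

lemma free_algebra_simps [simp]:
  "carrier (free_algebra X) = {p. Poly_Mapping.keys p \<subseteq> lists X}"
  "p \<otimes>\<^bsub>free_algebra X\<^esub> q = p * q"
  "p \<oplus>\<^bsub>free_algebra X\<^esub> q = p + q"
  "\<one>\<^bsub>free_algebra X\<^esub> = 1"
  "\<zero>\<^bsub>free_algebra X\<^esub> = 0"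
  by (simp_all add: free_algebra_def)

lemma keys_uminus [simp]: "Poly_Mapping.keys (- p) = Poly_Mapping.keys (p :: ('x, 'f::field) ncpoly)"
  by (auto simp: in_keys_iff)

lemma keys_mult_lists:
  "Poly_Mapping.keys p \<subseteq> lists X \<Longrightarrow> Poly_Mapping.keys q \<subseteq> lists X \<Longrightarrow> Poly_Mapping.keys (p * q) \<subseteq> lists X"
proof
  fix w assume pq: "Poly_Mapping.keys p \<subseteq> lists X" "Poly_Mapping.keys q \<subseteq> lists X"
    and "w \<in> Poly_Mapping.keys (p * q)"
  from keys_mult_append[OF this(3)] obtain u v
    where "u \<in> Poly_Mapping.keys p" "v \<in> Poly_Mapping.keys q" "w = u @ v" by blast
  moreover from this pq have "u \<in> lists X" "v \<in> lists X" by blast+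
  ultimately show "w \<in> lists X" by simp
qed

lemma keys_add_subset:
  "Poly_Mapping.keys p \<subseteq> S \<Longrightarrow> Poly_Mapping.keys q \<subseteq> S \<Longrightarrow> Poly_Mapping.keys (p + q) \<subseteq> S"
  using keys_add[of p q] by blast

lemma keys_diff_subset:
  "Poly_Mapping.keys p \<subseteq> S \<Longrightarrow> Poly_Mapping.keys q \<subseteq> S \<Longrightarrow>
    Poly_Mapping.keys (p - q :: ('x, 'f::field) ncpoly) \<subseteq> S"
  using keys_add_subset[of p S "- q"] by simp

lemma keys_sum_subset:
  "(\<And>a. a \<in> A \<Longrightarrow> Poly_Mapping.keys (f a) \<subseteq> S) \<Longrightarrow> Poly_Mapping.keys (sum f A) \<subseteq> S"
  by (induction A rule: infinite_finite_induct) (simp_all add: keys_add_subset)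

lemma keys_scalar_poly: "Poly_Mapping.keys (scalar_poly c) \<subseteq> lists X"
  by (simp add: scalar_poly_def)

lemma ring_free_algebra: "ring (free_algebra X :: ('x, 'f::field) ncpoly ring)"
proof (intro ringI abelian_groupI monoidI)
  fix p :: "('x, 'f) ncpoly" assume "p \<in> carrier (free_algebra X)"
  then show "\<exists>q\<in>carrier (free_algebra X). q \<oplus>\<^bsub>free_algebra X\<^esub> p = \<zero>\<^bsub>free_algebra X\<^esub>"
    by (intro bexI[of _ "- p"]) auto
qed (auto simp: keys_add_subset keys_mult_lists algebra_simps zero_list_def)

lemma free_algebra_uminus:
  "p \<in> carrier (free_algebra X) \<Longrightarrow> \<ominus>\<^bsub>free_algebra X\<^esub> p = - p"
  using ring_free_algebra by (intro abelian_group.minus_equality) (auto simp: ring_def)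

lemma free_algebra_minus:
  "p \<in> carrier (free_algebra X) \<Longrightarrow> q \<in> carrier (free_algebra X) \<Longrightarrow> p \<ominus>\<^bsub>free_algebra X\<^esub> q = p - q"
  by (simp add: a_minus_def free_algebra_uminus[simplified])

text \<open>Dimension in \<open>HOL-Algebra\<close> is taken over a subfield of the ring itself, so
  the field enters as the set of constants.\<close>

lemma subfield_scalars: "subfield (range scalar_poly) (free_algebra X :: ('x, 'f::field) ncpoly ring)"
proof -
  let ?A = "free_algebra X :: ('x, 'f) ncpoly ring" and ?K = "range scalar_poly :: ('x, 'f) ncpoly set"
  interpret ring ?A by (rule ring_free_algebra)
  have carr: "scalar_poly c \<in> carrier ?A" for c by (simp add: scalar_poly_def)
  show ?thesis
  proof (rule subfieldI)
    show "subcring ?K ?A"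
    proof (rule subcringI)
      show "subring ?K ?A"
      proof (rule subringI)
        show "\<one>\<^bsub>?A\<^esub> \<in> ?K" using scalar_poly_1 by (metis free_algebra_simps(4) rangeI)
        show "\<ominus>\<^bsub>?A\<^esub> h \<in> ?K" if "h \<in> ?K" for h
          using that carr by (auto simp: free_algebra_uminus scalar_poly_uminus[symmetric] simp del: free_algebra_simps(1))
      qed (use carr in \<open>auto simp: scalar_poly_mult scalar_poly_add[symmetric] simp del: free_algebra_simps(1)\<close>)
    qed (auto simp: scalar_poly_mult mult.commute)
    show "Units (?A\<lparr>carrier := ?K\<rparr>) = ?K - {\<zero>\<^bsub>?A\<^esub>}"
    proof (intro equalityI subsetI)
      fix p assume "p \<in> Units (?A\<lparr>carrier := ?K\<rparr>)"
      then show "p \<in> ?K - {\<zero>\<^bsub>?A\<^esub>}" by (auto simp: Units_def)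
    next
      fix p assume p: "p \<in> ?K - {\<zero>\<^bsub>?A\<^esub>}"
      then obtain c where c: "p = scalar_poly c" by auto
      with p have "c \<noteq> 0" by auto
      with c show "p \<in> Units (?A\<lparr>carrier := ?K\<rparr>)"
        by (auto simp: Units_def scalar_poly_mult intro!: exI[of _ "inverse c"])
    qed
  qed
qed

section \<open>Span and independence of words\<close>

lemma Span_words:
  assumes "set ws \<subseteq> lists X"
  shows "ring.Span (free_algebra X) (range scalar_poly) (map word ws) =
    {p :: ('x, 'f::field) ncpoly. Poly_Mapping.keys p \<subseteq> set ws}"
proof -
  let ?A = "free_algebra X :: ('x, 'f) ncpoly ring"
  interpret ring ?A by (rule ring_free_algebra)
  show ?thesis
    using assms
  proof (induction ws)
    case (Cons w ws)
    let ?S = "Span (range scalar_poly) (map word (w # ws))"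
    have iff: "p \<in> ?S \<longleftrightarrow> (\<exists>c q. Poly_Mapping.keys q \<subseteq> set ws \<and> p = Poly_Mapping.single w c + q)" for p
      using Cons by (simp add: line_extension_mem_iff scalar_poly_mult_single)
    show ?case
    proof (intro equalityI subsetI)
      fix p assume "p \<in> ?S"
      then obtain c q where "Poly_Mapping.keys q \<subseteq> set ws" "p = Poly_Mapping.single w c + q"
        unfolding iff by blast
      then show "p \<in> {p. Poly_Mapping.keys p \<subseteq> set (w # ws)}"
        using keys_add[of "Poly_Mapping.single w c" q] by (fastforce split: if_splits)
    next
      fix p :: "('x, 'f) ncpoly" assume "p \<in> {p. Poly_Mapping.keys p \<subseteq> set (w # ws)}"
      \<comment> \<open>Subtracting the \<open>w\<close>-term removes \<open>w\<close> from the
        support, and the induction hypothesis applies to the remainder.\<close>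
      moreover define c where "c = Poly_Mapping.lookup p w"
      ultimately have "Poly_Mapping.keys (p - Poly_Mapping.single w c) \<subseteq> set ws"
        by (auto simp: in_keys_iff lookup_minus lookup_single when_def split: if_splits)
      then show "p \<in> ?S"
        unfolding iff by (intro exI[of _ c] exI[of _ "p - Poly_Mapping.single w c"]) auto
    qed
  qed simp
qed

lemma independent_words:
  assumes "set ws \<subseteq> lists X" "distinct ws"
  shows "ring.independent (free_algebra X :: ('x, 'f::field) ncpoly ring) (range scalar_poly) (map word ws)"
proof -
  interpret ring "free_algebra X :: ('x, 'f) ncpoly ring" by (rule ring_free_algebra)
  show ?thesis
    using assms
  proof (induction ws)
    case (Cons w ws)
    have "word w \<notin> Span (range scalar_poly) (map word ws)"
      using Cons.prems by (subst Span_words) auto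
    with Cons show ?case by (auto intro!: li_Cons)
  qed simp
qed


section \<open>Quadratic rewriting systems\<close>

text \<open>The hypotheses of the diamond lemma. Resolvability of an overlap is phrased through an
  arbitrary linear \<open>G\<close> that already respects the rules on smaller words: it will be the
  normal form map between two fixed context words, inside the very induction that proves this map
  independent of choices. By \<open>rel_gen\<close> and \<open>rel_kill\<close>, the rules and
  \<open>R\<close> imply each other.\<close>

locale quadratic_rewriting =
  fixes X :: "'x set" and R :: "('x, 'f::field) ncpoly set"
    and rank :: "'x \<Rightarrow> nat" and red :: "'x \<Rightarrow> 'x \<Rightarrow> bool" and rhs :: "'x \<Rightarrow> 'x \<Rightarrow> ('x, 'f) ncpoly"
  assumes finite_X: "finite X"
    and rhs_keys: "red a b \<Longrightarrow> w \<in> Poly_Mapping.keys (rhs a b) \<Longrightarrow>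
      \<exists>c d. w = [c, d] \<and> c \<in> X \<and> d \<in> X \<and> rank c < rank a"
    and overlap: \<comment> \<open>the rank conditions say that \<open>a b c\<close> is lexicographically smaller than \<open>z y x\<close>\<close>
      "lin G \<Longrightarrow> red z y \<Longrightarrow> red y x \<Longrightarrow>
      (\<And>a b c. red a b \<Longrightarrow> rank a < rank z \<or> a = z \<and> rank b < rank y \<Longrightarrow>
        G (var a * var b * var c) = G (rhs a b * var c)) \<Longrightarrow>
      (\<And>a b c. red b c \<Longrightarrow> rank a < rank z \<or> a = z \<and> rank b < rank y \<Longrightarrow>
        G (var a * var b * var c) = G (var a * rhs b c)) \<Longrightarrow>
      G (rhs z y * var x) = G (var z * rhs y x)"
    and rel_carrier: "R \<subseteq> carrier (free_algebra X)"
    and rel_gen: "red a b \<Longrightarrow> var a * var b - rhs a b \<in> R \<or> rhs a b - var a * var b \<in> R"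
    and rel_kill: "lin G \<Longrightarrow> (\<And>a b. red a b \<Longrightarrow> G (var a * var b) = G (rhs a b)) \<Longrightarrow> r \<in> R \<Longrightarrow> G r = 0"
begin

section \<open>Reduction, normal forms and confluence\<close>

definition normal :: "'x list \<Rightarrow> bool"
  where "normal = successively (\<lambda>a b. \<not> red a b)"

lemma not_normal_iff: "\<not> normal w \<longleftrightarrow> (\<exists>u a b v. w = u @ [a, b] @ v \<and> red a b)"
proof
  assume "\<not> normal w"
  then show "\<exists>u a b v. w = u @ [a, b] @ v \<and> red a b"
  proof (induction w rule: induct_list012)
    case (3 x y zs)
    show ?case
    proof (cases "red x y")
      case True
      then show ?thesis by (intro exI[of _ "[]"]) auto
    next
      case False
      with 3 obtain u a b v where "y # zs = u @ [a, b] @ v" "red a b" by (auto simp: normal_def)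
      then show ?thesis by (intro exI[of _ "x # u"]) auto
    qed
  qed (auto simp: normal_def)
qed (auto simp: normal_def successively_append_iff successively_Cons)

text \<open>An arbitrary redex is chosen; by \<open>nf_redex\<close> any other one leads to the same
  normal form.\<close>

definition step :: "'x list \<Rightarrow> ('x, 'f) ncpoly"
  where "step w = (case (SOME (u, a, b, v). w = u @ [a, b] @ v \<and> red a b) of
    (u, a, b, v) \<Rightarrow> word u * rhs a b * word v)"

lemma step_cases:
  assumes "\<not> normal w"
  obtains u a b v where "w = u @ [a, b] @ v" "red a b" "step w = word u * rhs a b * word v"
proof -
  let ?P = "\<lambda>(u, a, b, v). w = u @ [a, b] @ v \<and> red a b"
  obtain u a b v where t: "(SOME t. ?P t) = (u, a, b, v)"
    by (rule prod_cases4)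
  then have "step w = word u * rhs a b * word v"
    by (simp add: step_def)
  moreover have "?P (SOME t. ?P t)"
    using assms unfolding not_normal_iff by (intro someI_ex[of ?P]) auto
  ultimately show ?thesis
    using that t by auto
qed

abbreviation less_words :: "('x list \<times> 'x list) set"
  where "less_words \<equiv> lenlex (measure rank)"

text \<open>Prefix and length stay, and the first replaced letter drops in rank.\<close>

lemma reduct_less:
  assumes "red a b" "w \<in> Poly_Mapping.keys (word u * rhs a b * word v)"
  shows "(w, u @ [a, b] @ v) \<in> less_words"
proof -
  from keys_sandwich[OF assms(2)] obtain t where t: "t \<in> Poly_Mapping.keys (rhs a b)" "w = u @ t @ v"
    by blast
  from rhs_keys[OF assms(1) t(1)] obtain c d where "t = [c, d]" "rank c < rank a" by blast
  with t(2) have "w = u @ [c] @ (d # v)" "rank c < rank a" by simp_all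
  then show ?thesis by (simp add: lenlex_append2 irrefl_def Cons_lenlex_iff)
qed

function nf_word :: "'x list \<Rightarrow> ('x, 'f) ncpoly"
  where "nf_word w = (if normal w then word w else
    (\<Sum>w'\<in>Poly_Mapping.keys (step w). scalar_poly (Poly_Mapping.lookup (step w) w') * nf_word w'))"
  by auto
termination
proof (relation less_words)
  fix w w' assume "\<not> normal w" "w' \<in> Poly_Mapping.keys (step w)"
  then show "(w', w) \<in> less_words" by (metis reduct_less step_cases)
qed (simp add: wf_lenlex)

declare nf_word.simps [simp del]

definition nf :: "('x, 'f) ncpoly \<Rightarrow> ('x, 'f) ncpoly"
  where "nf = extend nf_word"

lemma lin_nf: "lin nf"
  by (simp add: nf_def lin_extend)

lemma nf_word_normal: "normal w \<Longrightarrow> nf (word w) = word w"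
  by (simp add: nf_def extend_word nf_word.simps)

lemma nf_word_step: "\<not> normal w \<Longrightarrow> nf (word w) = nf (step w)"
  unfolding nf_def extend_word by (subst nf_word.simps) (simp add: extend_def)

text \<open>The induction step of Bergman's diamond lemma.\<close>

lemma reducts_joinable:
  assumes IH: "\<And>u a b v. (u @ [a, b] @ v, w) \<in> less_words \<Longrightarrow> red a b \<Longrightarrow>
      nf (word (u @ [a, b] @ v)) = nf (word u * rhs a b * word v)"
    and w: "w = u @ [a, b] @ v" "w = u' @ [c, d] @ v'" and red: "red a b" "red c d"
    and len: "length u \<le> length u'"
  shows "nf (word u * rhs a b * word v) = nf (word u' * rhs c d * word v')"
proof -
  from w len obtain t where t: "u' = u @ t" "[a, b] @ v = t @ [c, d] @ v'"
    by (auto simp: append_eq_append_conv2)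
  \<comment> \<open>The second redex equals the first, overlaps it in one letter, or lies entirely
    behind it.\<close>
  consider "t = []" | "t = [a]" | s where "t = a # b # s"
    using t(2) by (cases t; cases "tl t") auto
  then show ?thesis
  proof cases
    case 1
    with t show ?thesis by simp
  next
    case 2
    with t have eqs: "c = b" "v = d # v'" by auto
    \<comment> \<open>The overlap \<open>a b d\<close> is resolved in the fixed context
      \<open>u\<close>, \<open>v'\<close>; for smaller three-letter words in this context the
      induction hypothesis supplies the rules.\<close>
    define G where "G p = nf (word u * p * word v')" for p
    have "lin G" unfolding G_def by (rule lin_sandwich) (rule lin_nf)
    have less: "(u @ [e, f, g] @ v', w) \<in> less_words"
      if "rank e < rank a \<or> e = a \<and> rank f < rank b" for e f g
      using that w(1) eqs by (auto simp: lenlex_append2 irrefl_def Cons_lenlex_iff)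
    have "G (rhs a b * var d) = G (var a * rhs b d)"
    proof (rule overlap)
      show "lin G" by fact
      show "red a b" "red b d" using red eqs by auto
      fix e f g
      assume "red e f" and lt: "rank e < rank a \<or> e = a \<and> rank f < rank b"
      then show "G (var e * var f * var g) = G (rhs e f * var g)"
        using IH[of u e f "g # v'"] less[OF lt]
        by (simp add: G_def var_eq_word word_mult mult.assoc)
    next
      fix e f g
      assume "red f g" and lt: "rank e < rank a \<or> e = a \<and> rank f < rank b"
      then show "G (var e * var f * var g) = G (var e * rhs f g)"
        using IH[of "u @ [e]" f g v'] less[OF lt]
        by (simp add: G_def var_eq_word word_mult mult.assoc[symmetric])
    qed
    then show ?thesis using 2 t eqs
      by (simp add: G_def var_eq_word word_mult mult.assoc[symmetric])
         (simp add: word_mult mult.assoc)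
  next
    case 3
    with t have eqs: "v = s @ [c, d] @ v'" "u' = u @ [a, b] @ s" by auto
    \<comment> \<open>Each reduct is reduced further at the other redex, which leads both to the
      product containing \<open>rhs a b\<close> and \<open>rhs c d\<close>. All words met on the way
      are smaller than \<open>w\<close>.\<close>
    have "nf (word u * rhs a b * word v) = nf (word u * rhs a b * (word s * rhs c d * word v'))"
    proof (rule lin_eqI[where G = "\<lambda>p. nf (word u * p * word v)"
          and H = "\<lambda>p. nf (word u * p * (word s * rhs c d * word v'))"])
      fix t assume "t \<in> Poly_Mapping.keys (rhs a b)"
      then obtain e f where "t = [e, f]" "rank e < rank a" using rhs_keys[OF red(1)] by blast
      then have "((u @ t @ s) @ [c, d] @ v', w) \<in> less_words"
        by (simp add: w(1) eqs lenlex_append2 irrefl_def Cons_lenlex_iff)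
      from IH[OF this red(2)] show
        "nf (word u * word t * word v) = nf (word u * word t * (word s * rhs c d * word v'))"
        by (simp add: eqs word_mult) (simp add: word_mult mult.assoc[symmetric])
    qed (intro lin_sandwich lin_nf)+
    also have "\<dots> = nf ((word u * rhs a b * word s) * rhs c d * word v')"
      by (simp add: mult.assoc)
    also have "\<dots> = nf (word u' * rhs c d * word v')"
    proof (rule lin_eqI[where H = "\<lambda>p. nf (word u' * p * word v')"
          and G = "\<lambda>p. nf ((word u * rhs a b * word s) * p * word v')"])
      fix t assume "t \<in> Poly_Mapping.keys (rhs c d)"
      then obtain e f where "t = [e, f]" "rank e < rank c" using rhs_keys[OF red(2)] by blast
      then have "(u @ [a, b] @ (s @ t @ v'), w) \<in> less_words"
        by (simp add: w(1) eqs lenlex_append2 irrefl_def Cons_lenlex_iff)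
      from IH[OF this red(1)] show
        "nf ((word u * rhs a b * word s) * word t * word v') = nf (word u' * word t * word v')"
        by (simp add: eqs word_mult) (simp add: word_mult mult.assoc)
    qed (intro lin_sandwich lin_nf)+
    finally show ?thesis .
  qed
qed

text \<open>Well-founded induction on the whole word: an arbitrary reduct is compared with the one
  chosen by \<open>step\<close>.\<close>

lemma nf_redex:
  assumes "red a b"
  shows "nf (word (u @ [a, b] @ v)) = nf (word u * rhs a b * word v)"
proof -
  have "\<forall>u a b v. w = u @ [a, b] @ v \<longrightarrow> red a b \<longrightarrow> nf (word w) = nf (word u * rhs a b * word v)" for w
  proof (induction w rule: wf_induct_rule[OF wf_lenlex[OF wf_measure[of rank]]])
    case (1 w)
    show ?case
    proof (intro allI impI)
      fix u a b v assume w: "w = u @ [a, b] @ v" and ab: "red a b"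
      then have "\<not> normal w" using not_normal_iff by blast
      then obtain u' c d v' where s: "w = u' @ [c, d] @ v'" "red c d"
          "step w = word u' * rhs c d * word v'"
        by (rule step_cases)
      have IH: "nf (word (u @ [a, b] @ v)) = nf (word u * rhs a b * word v)"
        if "(u @ [a, b] @ v, w) \<in> less_words" "red a b" for u a b v
        using 1 that by blast
      \<comment> \<open>\<open>reducts_joinable\<close> expects the redex further to the left first,
        so it is used in both orders.\<close>
      have "nf (word u * rhs a b * word v) = nf (word u' * rhs c d * word v')"
        using reducts_joinable[OF IH w s(1) ab s(2)] reducts_joinable[OF IH s(1) w s(2) ab]
        by (cases "length u \<le> length u'") auto
      then show "nf (word w) = nf (word u * rhs a b * word v)"
        using nf_word_step[OF \<open>\<not> normal w\<close>] s(3) by simp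
    qed
  qed
  with assms show ?thesis by blast
qed

section \<open>Normal forms modulo the relation ideal\<close>

abbreviation I :: "('x, 'f) ncpoly set" where "I \<equiv> relation_ideal X R"

lemma ideal_I: "ideal I (free_algebra X)"
  unfolding relation_ideal_def by (intro ring.genideal_ideal ring_free_algebra rel_carrier)

lemma I_mult_left: "p \<in> I \<Longrightarrow> Poly_Mapping.keys q \<subseteq> lists X \<Longrightarrow> q * p \<in> I"
  and I_mult_right: "p \<in> I \<Longrightarrow> Poly_Mapping.keys q \<subseteq> lists X \<Longrightarrow> p * q \<in> I"
  using ideal.I_l_closed[OF ideal_I] ideal.I_r_closed[OF ideal_I] by fastforce+

lemma I_uminus: "p \<in> I \<Longrightarrow> - p \<in> I"
  using I_mult_left[OF _ keys_scalar_poly, of p "- 1"] by (simp add: scalar_poly_uminus)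

lemma I_0: "0 \<in> I"
  using additive_subgroup.zero_closed[OF ideal.axioms(1)[OF ideal_I]] by simp

lemma I_add: "p \<in> I \<Longrightarrow> q \<in> I \<Longrightarrow> p + q \<in> I"
  using additive_subgroup.a_closed[OF ideal.axioms(1)[OF ideal_I]] by fastforce

lemma I_sum: "(\<And>a. a \<in> A \<Longrightarrow> f a \<in> I) \<Longrightarrow> sum f A \<in> I"
  by (induction A rule: infinite_finite_induct) (auto simp: I_0 I_add)

lemma R_subset_I: "R \<subseteq> I"
  unfolding relation_ideal_def by (intro ring.genideal_self ring_free_algebra rel_carrier)

lemma rule_in_I: "red a b \<Longrightarrow> var a * var b - rhs a b \<in> I"
  using rel_gen R_subset_I I_uminus by fastforce

text \<open>The spanning half of the basis theorem: a reduction step keeps length and alphabet and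
  changes the word by an element of the ideal.\<close>

lemma nf_word_props:
  assumes "w \<in> lists X"
  shows "Poly_Mapping.keys (nf (word w)) \<subseteq> {v \<in> lists X. length v = length w \<and> normal v}
    \<and> word w - nf (word w) \<in> I"
  using assms
proof (induction w rule: wf_induct_rule[OF wf_lenlex[OF wf_measure[of rank]]])
  case (1 w)
  show ?case
  proof (cases "normal w")
    case True
    with 1 show ?thesis by (simp add: nf_word_normal I_0)
  next
    case False
    then obtain u a b v where w: "w = u @ [a, b] @ v" "red a b" and st: "step w = word u * rhs a b * word v"
      by (rule step_cases)
    have smaller: "(t, w) \<in> less_words \<and> t \<in> lists X \<and> length t = length w"
      if t: "t \<in> Poly_Mapping.keys (step w)" for t
    proof -
      from keys_sandwich[OF t[unfolded st]] obtain s where s: "s \<in> Poly_Mapping.keys (rhs a b)" "t = u @ s @ v"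
        by blast
      with rhs_keys[OF w(2) s(1)] 1(2) w(1) reduct_less[OF w(2) t[unfolded st]] show ?thesis by auto
    qed
    let ?c = "\<lambda>t. scalar_poly (Poly_Mapping.lookup (step w) t)"
    have nf_w: "nf (word w) = (\<Sum>t\<in>Poly_Mapping.keys (step w). ?c t * nf (word t))"
      using nf_word_step[OF False] lin_expansion[OF lin_nf, of "step w"] by simp
    have "Poly_Mapping.keys (nf (word w)) \<subseteq> {v \<in> lists X. length v = length w \<and> normal v}"
      unfolding nf_w
    proof (rule keys_sum_subset)
      fix t assume "t \<in> Poly_Mapping.keys (step w)"
      with smaller[OF this] 1(1)[of t]
      show "Poly_Mapping.keys (?c t * nf (word t)) \<subseteq> {v \<in> lists X. length v = length w \<and> normal v}"
        by (intro order.trans[OF keys_scalar_poly_mult]) auto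
    qed
    moreover have "word w - nf (word w) \<in> I"
    proof -
      \<comment> \<open>The difference is \<open>word w - step w\<close>, a rule in context, plus
        \<open>step w - nf (word w)\<close>, which the induction hypothesis handles word by
        word.\<close>
      have "word u * (var a * var b - rhs a b) * word v \<in> I"
        using 1(2) w(1) rule_in_I[OF w(2)] by (intro I_mult_left I_mult_right) auto
      moreover have "word w - step w = word u * (var a * var b - rhs a b) * word v"
        unfolding st unfolding w(1)
        by (simp add: right_diff_distrib left_diff_distrib var_eq_word word_mult)
      ultimately have "word w - step w \<in> I" by simp
      moreover have "(\<Sum>t\<in>Poly_Mapping.keys (step w). ?c t * (word t - nf (word t))) \<in> I"
        using smaller 1(1) by (intro I_sum I_mult_left keys_scalar_poly) auto
      moreover have "(\<Sum>t\<in>Poly_Mapping.keys (step w). ?c t * (word t - nf (word t))) = step w - nf (word w)"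
        using poly_expansion[of "step w"] by (simp add: nf_w algebra_simps sum_subtractf)
      ultimately show ?thesis using I_add by fastforce
    qed
    ultimately show ?thesis ..
  qed
qed

lemma nf_keys:
  assumes "p \<in> homogeneous X i"
  shows "Poly_Mapping.keys (nf p) \<subseteq> {v \<in> lists X. length v = i \<and> normal v}"
  unfolding lin_expansion[OF lin_nf, of p]
proof (rule keys_sum_subset)
  fix w assume "w \<in> Poly_Mapping.keys p"
  with assms nf_word_props[of w]
  show "Poly_Mapping.keys (scalar_poly (Poly_Mapping.lookup p w) * nf (word w)) \<subseteq>
      {v \<in> lists X. length v = i \<and> normal v}"
    by (intro order.trans[OF keys_scalar_poly_mult]) (auto simp: homogeneous_def)
qed

lemma diff_nf_in_I:
  assumes "Poly_Mapping.keys p \<subseteq> lists X"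
  shows "p - nf p \<in> I"
proof -
  have "(\<Sum>w\<in>Poly_Mapping.keys p. scalar_poly (Poly_Mapping.lookup p w) * (word w - nf (word w))) \<in> I"
  proof (intro I_sum I_mult_left keys_scalar_poly)
    fix w assume "w \<in> Poly_Mapping.keys p"
    with assms show "word w - nf (word w) \<in> I" using nf_word_props by blast
  qed
  then show ?thesis
    using poly_expansion[of p] lin_expansion[OF lin_nf, of p] by (simp add: algebra_simps sum_subtractf)
qed

lemma nf_normal:
  assumes "\<And>w. w \<in> Poly_Mapping.keys p \<Longrightarrow> normal w"
  shows "nf p = p"
proof (rule lin_eqI[OF lin_nf, where H = "\<lambda>p. p"])
  show "lin (\<lambda>p :: ('x, 'f) ncpoly. p)" by (simp add: lin_def)
qed (use assms in \<open>simp add: nf_word_normal\<close>)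

text \<open>The independence half: since \<open>nf\<close> fixes combinations of normal words, none
  of them but \<open>0\<close> lies in the ideal. It suffices to find an ideal that contains
  \<open>R\<close> and is killed by \<open>nf\<close>.\<close>

lemma nf_I:
  assumes "p \<in> I"
  shows "nf p = 0"
proof -
  let ?A = "free_algebra X :: ('x, 'f) ncpoly ring"
  \<comment> \<open>Quantifying over all contexts gives closure under multiplication from both
    sides, which is not evident for the kernel of \<open>nf\<close> itself.\<close>
  define K where "K = {p \<in> carrier ?A. \<forall>u v. nf (word u * p * word v) = 0}"
  have lin: "lin (\<lambda>p. nf (word u * p * word v))" for u v
    by (intro lin_sandwich lin_nf)
  interpret ring ?A by (rule ring_free_algebra)
  have "ideal K ?A"
  proof (rule idealI)
    show "subgroup K (add_monoid ?A)"
    proof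
      fix p q assume "p \<in> K" "q \<in> K"
      then show "p \<otimes>\<^bsub>add_monoid ?A\<^esub> q \<in> K"
        using lin_add[OF lin, where p = p and q = q] by (simp add: K_def keys_add_subset)
    next
      fix p assume "p \<in> K"
      then have "inv\<^bsub>add_monoid ?A\<^esub> p = - p"
        using free_algebra_uminus[of p X] by (simp add: K_def a_inv_def)
      with \<open>p \<in> K\<close> show "inv\<^bsub>add_monoid ?A\<^esub> p \<in> K"
        using lin_uminus[OF lin, where p = p] by (simp add: K_def)
    qed (auto simp: K_def lin_0[OF lin_nf])
  next
    fix p q assume pq: "p \<in> K" "q \<in> carrier ?A"
    have "nf (word u * (q * p) * word v) = 0" for u v
    proof -
      \<comment> \<open>By linearity the factor \<open>q\<close> may be taken to be a word, which
        the context then absorbs.\<close>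
      have "lin (\<lambda>q. nf (word u * (q * p) * word v))"
        using lin_sandwich[OF lin_nf, of "word u" "p * word v"] by (simp add: mult.assoc)
      moreover have "nf (word u * (word t * p) * word v) = 0" for t
      proof -
        have "word u * (word t * p) * word v = word (u @ t) * p * word v"
          by (simp add: word_mult[symmetric] mult.assoc)
        then show ?thesis using pq by (simp add: K_def)
      qed
      ultimately show ?thesis
        using lin_expansion[of "\<lambda>q. nf (word u * (q * p) * word v)" q] by simp
    qed
    with pq show "q \<otimes>\<^bsub>?A\<^esub> p \<in> K" by (simp add: K_def keys_mult_lists)
    have "nf (word u * (p * q) * word v) = 0" for u v
    proof -
      have "lin (\<lambda>q. nf (word u * (p * q) * word v))"
        using lin_sandwich[OF lin_nf, of "word u * p" "word v"] by (simp add: mult.assoc)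
      moreover have "nf (word u * (p * word t) * word v) = 0" for t
      proof -
        have "word u * (p * word t) * word v = word u * p * word (t @ v)"
          by (simp add: word_mult[symmetric] mult.assoc)
        then show ?thesis using pq by (simp add: K_def)
      qed
      ultimately show ?thesis
        using lin_expansion[of "\<lambda>q. nf (word u * (p * q) * word v)" q] by simp
    qed
    with pq show "p \<otimes>\<^bsub>?A\<^esub> q \<in> K" by (simp add: K_def keys_mult_lists)
  qed (rule ring_free_algebra)
  moreover have "R \<subseteq> K"
  proof
    fix r assume r: "r \<in> R"
    have "nf (word u * r * word v) = 0" for u v
    proof (rule rel_kill[OF lin _ r])
      fix a b assume "red a b"
      then show "nf (word u * (var a * var b) * word v) = nf (word u * rhs a b * word v)"
        using nf_redex[of a b u v] by (simp add: var_eq_word word_mult)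
    qed
    with r rel_carrier show "r \<in> K" by (auto simp: K_def)
  qed
  ultimately have "I \<subseteq> K"
    unfolding relation_ideal_def by (rule genideal_minimal)
  with assms have "nf (word [] * p * word []) = 0" by (auto simp: K_def)
  then show ?thesis by (simp add: word_Nil)
qed

text \<open>The span of the normal words of length \<open>i\<close> maps bijectively onto the graded
  component: injectively because \<open>nf\<close> fixes it and kills the ideal, onto because
  \<open>p\<close> and \<open>nf p\<close> are congruent.\<close>

theorem dim_graded_component:
  "(ring.dim (presented_algebra X R) over scalars X R) (graded_component X R i) =
    card {w \<in> lists X. length w = i \<and> normal w}"
proof -
  let ?A = "free_algebra X :: ('x, 'f) ncpoly ring" and ?Q = "presented_algebra X R"
  let ?h = "residue_class X R" and ?K = "range scalar_poly :: ('x, 'f) ncpoly set"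
  have "ring_hom_ring ?A ?Q ?h"
    unfolding residue_class_def presented_algebra_def by (rule ideal.rcos_ring_hom_ring[OF ideal_I])
  then interpret h: ring_hom_ring ?A ?Q ?h .
  have eq_iff: "?h p = ?h q \<longleftrightarrow> p - q \<in> I"
    if "Poly_Mapping.keys p \<subseteq> lists X" "Poly_Mapping.keys q \<subseteq> lists X" for p q
    unfolding residue_class_def
    using h.R.quotient_eq_iff_same_a_r_cos[OF ideal_I, of p q] free_algebra_minus[of p X q] that by simp
  define N where "N = {w \<in> lists X. length w = i \<and> normal w}"
  have "finite N"
    unfolding N_def by (rule finite_subset[OF _ finite_lists_length_eq[OF finite_X, of i]]) auto
  then obtain ws where ws: "set ws = N" "distinct ws" "length ws = card N"
    using finite_distinct_list distinct_card by metis
  have N: "N \<subseteq> lists X" by (auto simp: N_def)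
  \<comment> \<open>The empty word is normal, hence fixed by \<open>nf\<close>, so \<open>1\<close>
    is not in the ideal and the field embeds into the quotient.\<close>
  have nontrivial: "\<one>\<^bsub>?Q\<^esub> \<noteq> \<zero>\<^bsub>?Q\<^esub>"
  proof
    assume "\<one>\<^bsub>?Q\<^esub> = \<zero>\<^bsub>?Q\<^esub>"
    then have "?h 1 = ?h 0" using h.hom_one h.hom_zero by simp
    then have "word [] \<in> I" using eq_iff[of 1 0] by (simp add: word_Nil zero_list_def)
    then show False
      using nf_I nf_word_normal[of "[]"] by (simp add: normal_def word_Nil)
  qed
  have "h.R.independent ?K (map word ws)"
    using N ws by (intro independent_words) auto
  from h.R.dimension_independent[OF this]
  have dim: "h.R.dimension (card N) ?K {p. Poly_Mapping.keys p \<subseteq> N}"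
    using N ws by (simp add: Span_words del: h.R.Span.simps)
  have "inj_on ?h {p. Poly_Mapping.keys p \<subseteq> N}"
  proof (rule inj_onI)
    fix p q assume pq: "p \<in> {p. Poly_Mapping.keys p \<subseteq> N}" "q \<in> {p. Poly_Mapping.keys p \<subseteq> N}" "?h p = ?h q"
    with N have "p - q \<in> I" by (subst eq_iff[symmetric]) auto
    then have "nf (p - q) = 0" by (rule nf_I)
    moreover have "nf (p - q) = p - q"
      using pq keys_diff_subset[of p N q] by (intro nf_normal) (auto simp: N_def)
    ultimately show "p = q" by simp
  qed
  from h.inj_hom_dimension[OF subfield_scalars nontrivial this dim]
  have "h.S.dimension (card N) (scalars X R) (?h ` {p. Poly_Mapping.keys p \<subseteq> N})"
    by (simp add: scalars_def)
  moreover have "?h ` {p. Poly_Mapping.keys p \<subseteq> N} = graded_component X R i"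
    unfolding graded_component_def
  proof (intro equalityI subsetI)
    fix c assume "c \<in> ?h ` {p. Poly_Mapping.keys p \<subseteq> N}"
    then obtain p where "Poly_Mapping.keys p \<subseteq> N" "c = ?h p" by auto
    moreover from this have "p \<in> homogeneous X i" unfolding homogeneous_def N_def by blast
    ultimately show "c \<in> ?h ` homogeneous X i" by simp
  next
    fix c assume "c \<in> ?h ` homogeneous X i"
    then obtain p where p: "p \<in> homogeneous X i" "c = ?h p" by auto
    from nf_keys[OF p(1)] have nf_p: "Poly_Mapping.keys (nf p) \<subseteq> N" by (simp add: N_def)
    have "?h p = ?h (nf p)"
      using p(1) nf_p N diff_nf_in_I[of p] by (subst eq_iff) (auto simp: homogeneous_def)
    with nf_p p(2) show "c \<in> ?h ` {p. Poly_Mapping.keys p \<subseteq> N}" by auto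
  qed
  moreover have "subfield (scalars X R) ?Q"
    unfolding scalars_def by (rule h.img_is_subfield(2)[OF subfield_scalars nontrivial])
  ultimately show ?thesis
    using h.S.dimI by (simp add: N_def)
qed

theorem hilbert_series_eq:
  "hilbert_series X R = Abs_fps (\<lambda>i. of_nat (card {w \<in> lists X. length w = i \<and> normal w}))"
  by (simp add: hilbert_series_def dim_graded_component)

end


section \<open>Counting words\<close>

definition words_of :: "'x set \<Rightarrow> ('x \<Rightarrow> 'x \<Rightarrow> bool) \<Rightarrow> nat \<Rightarrow> 'x list set"
  where "words_of X Q i = {w \<in> lists X. length w = i \<and> successively Q w}"

lemma finite_words_of: "finite X \<Longrightarrow> finite (words_of X Q i)"
  by (rule finite_subset[OF _ finite_lists_length_eq[of X i]]) (auto simp: words_of_def)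

lemma card_words_of_rev: "card (words_of X (\<lambda>a b. Q b a) i) = card (words_of X Q i)"
  by (rule bij_betw_same_card[of rev], rule bij_betw_byWitness[where f' = rev]) (auto simp: words_of_def)

lemma alternating_telescope:
  fixes d :: "nat \<Rightarrow> 'a::comm_ring_1"
  shows "(\<Sum>k\<le>m. (- 1) ^ k * (d k + d (Suc k))) = d 0 + (- 1) ^ m * d (Suc m)"
  by (induction m) (simp_all add: algebra_simps)

text \<open>In the product of the two counts at degree \<open>m\<close>, a pair of words is a word of length \<open>m\<close> with a
  marked cut; the cut letters are related by \<open>Q\<close> or not, which makes the alternating sum telescope.\<close>

lemma words_of_alternating_sum:
  assumes "finite X" "m > 0"
  shows "(\<Sum>k\<le>m. (- 1) ^ k * of_nat (card (words_of X Q k) * card (words_of X (\<lambda>a b. \<not> Q a b) (m - k))))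
    = (0 :: rat)"
proof -
  let ?N = "\<lambda>a b. \<not> Q a b"
  define W where "W = {w \<in> lists X. length w = m}"
  \<comment> \<open>\<open>S k\<close> has its cut after \<open>k\<close> letters. In
    \<open>T k\<close> the two chains share the \<open>k\<close>-th letter, so the pair across the
    cut decides between \<open>T k\<close> and \<open>T (Suc k)\<close>. The bounds on
    \<open>k\<close> make both ends of the telescope empty.\<close>
  define S where "S k = {w \<in> W. successively Q (take k w) \<and> successively ?N (drop k w)}" for k
  define T where "T k = {w \<in> W. 0 < k \<and> k \<le> m \<and> successively Q (take k w) \<and> successively ?N (drop (k - 1) w)}" for k
  have "finite W" unfolding W_def by (rule finite_subset[OF _ finite_lists_length_eq[OF assms(1), of m]]) auto
  then have fin: "finite (T k)" for k by (simp add: T_def)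
  have card_S: "card (S k) = card (words_of X Q k) * card (words_of X ?N (m - k))" if "k \<le> m" for k
  proof -
    have "bij_betw (\<lambda>w. (take k w, drop k w)) (S k) (words_of X Q k \<times> words_of X ?N (m - k))"
      by (rule bij_betw_byWitness[where f' = "\<lambda>(u, v). u @ v"])
         (use that in \<open>auto simp: S_def W_def words_of_def dest: in_set_takeD in_set_dropD\<close>)
    then show ?thesis by (simp add: bij_betw_same_card card_cartesian_product)
  qed
  have split: "card (S k) = card (T k) + card (T (Suc k))" if "k \<le> m" for k
  proof -
    have "w \<in> S k \<longleftrightarrow> w \<in> T k \<union> T (Suc k)" and "\<not> (w \<in> T k \<and> w \<in> T (Suc k))" if w: "w \<in> W" for w
    proof -
      have len: "length w = m" using w by (simp add: W_def)
      have "(w \<in> S k \<longleftrightarrow> w \<in> T k \<union> T (Suc k)) \<and> \<not> (w \<in> T k \<and> w \<in> T (Suc k))"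
      proof (cases "k = 0 \<or> k = m")
        case True
        \<comment> \<open>At an extreme cut one side is empty, and the extra chain condition
          concerns a single letter.\<close>
        have short: "successively P xs" if "length xs \<le> 1" for P and xs :: "'a list"
          using that by (cases xs) auto
        have "successively P (take (Suc 0) w)" "successively P (drop (m - Suc 0) w)" for P
          using len by (auto intro!: short)
        with True w assms(2) len show ?thesis by (auto simp: S_def T_def Suc_le_eq)
      next
        case False
        \<comment> \<open>The cut falls between \<open>a\<close> and \<open>b\<close>.\<close>
        then obtain u a b v where uv: "w = u @ a # b # v" "length u = k - 1"
        proof -
          from False \<open>k \<le> m\<close> len have "drop (k - 1) w = w ! (k - 1) # w ! k # drop (Suc k) w"
            by (metis Cons_nth_drop_Suc Suc_pred' le_neq_implies_less less_imp_diff_less not_gr0)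
          then show thesis
            using that[of "take (k - 1) w" "w ! (k - 1)" "w ! k" "drop (Suc k) w"] append_take_drop_id[of "k - 1" w] \<open>k \<le> m\<close> len by auto
        qed
        then have "take k w = u @ [a]" "drop k w = b # v" "take (Suc k) w = u @ [a, b]" "drop (k - 1) w = a # b # v"
          using False by (cases k; simp)+
        with w False \<open>k \<le> m\<close> show ?thesis
          by (auto simp: S_def T_def successively_append_iff)
      qed
      then show "w \<in> S k \<longleftrightarrow> w \<in> T k \<union> T (Suc k)" and "\<not> (w \<in> T k \<and> w \<in> T (Suc k))" by blast+
    qed
    moreover have "S k \<subseteq> W" "T k \<subseteq> W" "T (Suc k) \<subseteq> W" by (auto simp: S_def T_def)
    ultimately have "S k = T k \<union> T (Suc k)" "T k \<inter> T (Suc k) = {}" by blast+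
    then show ?thesis by (simp add: card_Un_disjoint fin)
  qed
  have "(\<Sum>k\<le>m. (- 1) ^ k * of_nat (card (words_of X Q k) * card (words_of X ?N (m - k))))
      = (\<Sum>k\<le>m. (- 1) ^ k * (of_nat (card (T k)) + of_nat (card (T (Suc k)))) :: rat)"
  proof (intro sum.cong refl)
    fix k assume "k \<in> {..m}"
    then have "card (words_of X Q k) * card (words_of X ?N (m - k)) = card (T k) + card (T (Suc k))"
      using card_S[of k] split[of k] by simp
    then show "(- 1) ^ k * of_nat (card (words_of X Q k) * card (words_of X ?N (m - k)))
        = ((- 1) ^ k * (of_nat (card (T k)) + of_nat (card (T (Suc k)))) :: rat)"
      by (simp only: of_nat_add)
  qed
  also have "\<dots> = of_nat (card (T 0)) + (- 1) ^ m * of_nat (card (T (Suc m)))"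
    by (rule alternating_telescope)
  also have "\<dots> = 0" by (simp add: T_def)
  finally show ?thesis .
qed

text \<open>\<open>words_of_alternating_sum\<close> kills all coefficients of the product in
  positive degree; in degree \<open>0\<close> both factors count the empty word.\<close>

lemma words_of_series:
  assumes "finite X"
  shows "Abs_fps (\<lambda>i. of_nat (card (words_of X (\<lambda>a b. \<not> Q a b) i)))
    = 1 / (Abs_fps (\<lambda>i. of_nat (card (words_of X Q i))) oo (- fps_X) :: rat fps)"
proof -
  let ?A = "Abs_fps (\<lambda>i. of_nat (card (words_of X (\<lambda>a b. \<not> Q a b) i))) :: rat fps"
  let ?B = "Abs_fps (\<lambda>i. of_nat (card (words_of X Q i))) :: rat fps"
  have B: "?B oo (- fps_X) = Abs_fps (\<lambda>i. (- 1) ^ i * of_nat (card (words_of X Q i)))"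
  proof -
    have "fps_const (- 1) * fps_X = (- fps_X :: rat fps)" by (simp flip: fps_const_neg)
    then show ?thesis using fps_compose_linear[of ?B "- 1"] by simp
  qed
  have empty: "words_of X Q' 0 = {[]}" for Q' :: "'a \<Rightarrow> 'a \<Rightarrow> bool"
    by (auto simp: words_of_def)
  have "(?B oo (- fps_X)) * ?A = 1"
  proof (rule fps_ext)
    fix m
    show "fps_nth ((?B oo (- fps_X)) * ?A) m = fps_nth 1 m"
    proof (cases "m = 0")
      case False
      with words_of_alternating_sum[OF assms, of m Q] show ?thesis
        by (simp add: B fps_mult_nth atLeast0AtMost mult.assoc)
    qed (simp add: B empty)
  qed
  then have "?A = inverse (?B oo (- fps_X))"
    by (metis fps_inverse_unique)
  then show ?thesis
    by (simp add: fps_divide_unit B empty)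
qed

section \<open>Generators as intervals and chains from left to right\<close>

fun lo :: "gen \<Rightarrow> nat" where "lo (Vg i) = i" | "lo (Eg i) = i"
fun hi :: "gen \<Rightarrow> nat" where "hi (Vg i) = i" | "hi (Eg i) = Suc i"

definition left :: "gen \<Rightarrow> gen \<Rightarrow> bool" where "left x y \<longleftrightarrow> hi x < lo y"

lemma lo_le_hi: "lo x \<le> hi x" by (cases x) auto

lemma left_trans: "left x y \<Longrightarrow> left y z \<Longrightarrow> left x z"
  using lo_le_hi[of y] by (auto simp: left_def)

lemma left_irrefl: "\<not> left x x"
  using lo_le_hi[of x] by (auto simp: left_def)

lemma left_asym: "left x y \<Longrightarrow> \<not> left y x"
  using left_trans left_irrefl by blast

text \<open>One description for points and edges, so that the generators to the left of a given one
  again form some \<open>P_gens m\<close>.\<close>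

lemma P_gens_iff: "x \<in> P_gens m \<longleftrightarrow> 1 \<le> lo x \<and> hi x \<le> m"
  by (cases x) (auto simp: P_gens_def)

lemma finite_P_gens: "finite (P_gens n)"
  by (simp add: P_gens_def)

text \<open>By transitivity all letters lie left of the last one. Splitting there, rather than at
  the head, leaves a path that still starts at \<open>1\<close>.\<close>

lemma words_of_left_Suc:
  "words_of (P_gens m) left (Suc i) = (\<Union>x\<in>P_gens m. (\<lambda>w. w @ [x]) ` words_of (P_gens (lo x - 1)) left i)"
proof -
  have sorted: "successively left w \<longleftrightarrow> sorted_wrt left w" for w
    by (rule successively_conv_sorted_wrt) (auto simp: transp_def intro: left_trans)
  have left_iff: "y \<in> P_gens m \<and> left y x \<longleftrightarrow> y \<in> P_gens (lo x - 1)" if "x \<in> P_gens m" for x y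
    using that lo_le_hi[of x] by (auto simp: P_gens_iff left_def)
  have *: "w @ [x] \<in> words_of (P_gens m) left (Suc i) \<longleftrightarrow>
      x \<in> P_gens m \<and> w \<in> words_of (P_gens (lo x - 1)) left i" for w x
  proof -
    have "w @ [x] \<in> words_of (P_gens m) left (Suc i) \<longleftrightarrow>
        x \<in> P_gens m \<and> (\<forall>y\<in>set w. y \<in> P_gens m \<and> left y x) \<and> length w = i \<and> sorted_wrt left w"
      by (auto simp: words_of_def sorted sorted_wrt_append)
    also have "\<dots> \<longleftrightarrow> x \<in> P_gens m \<and> (\<forall>y\<in>set w. y \<in> P_gens (lo x - 1)) \<and> length w = i \<and> sorted_wrt left w"
      using left_iff by blast
    also have "\<dots> \<longleftrightarrow> x \<in> P_gens m \<and> w \<in> words_of (P_gens (lo x - 1)) left i"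
      by (auto simp: words_of_def sorted)
    finally show ?thesis .
  qed
  show ?thesis
  proof (intro equalityI subsetI)
    fix w assume w: "w \<in> words_of (P_gens m) left (Suc i)"
    then have "w \<noteq> []" by (auto simp: words_of_def)
    with w * show "w \<in> (\<Union>x\<in>P_gens m. (\<lambda>w. w @ [x]) ` words_of (P_gens (lo x - 1)) left i)"
      by (cases w rule: rev_cases) auto
  qed (use * in auto)
qed

lemma card_words_of_left_Suc:
  "card (words_of (P_gens m) left (Suc i)) = (\<Sum>x\<in>P_gens m. card (words_of (P_gens (lo x - 1)) left i))"
proof -
  have "card (words_of (P_gens m) left (Suc i)) =
      (\<Sum>x\<in>P_gens m. card ((\<lambda>w. w @ [x]) ` words_of (P_gens (lo x - 1)) left i))"
    unfolding words_of_left_Suc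
    by (rule card_UN_disjoint) (auto simp: finite_P_gens finite_words_of)
  then show ?thesis by (simp add: card_image inj_on_def)
qed

lemma P_gens_Suc_Suc: "P_gens (Suc (Suc n)) = insert (Vg (Suc (Suc n))) (insert (Eg (Suc n)) (P_gens (Suc n)))"
proof -
  have "x \<in> P_gens (Suc (Suc n)) \<longleftrightarrow> x \<in> insert (Vg (Suc (Suc n))) (insert (Eg (Suc n)) (P_gens (Suc n)))" for x
    by (cases x) (auto simp: P_gens_iff)
  then show ?thesis by blast
qed

text \<open>Sorted by last letter: \<open>Vg (n + 2)\<close> leaves a word over
  \<open>P_gens (n + 1)\<close>, \<open>Eg (n + 1)\<close> one over \<open>P_gens n\<close>; with
  any other last letter the whole word is over \<open>P_gens (n + 1)\<close>.\<close>

lemma card_words_of_left_rec: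
  "card (words_of (P_gens (Suc (Suc n))) left (Suc i)) =
    card (words_of (P_gens (Suc n)) left (Suc i)) + card (words_of (P_gens (Suc n)) left i)
      + card (words_of (P_gens n) left i)"
proof -
  have "Vg (Suc (Suc n)) \<notin> insert (Eg (Suc n)) (P_gens (Suc n))" "Eg (Suc n) \<notin> P_gens (Suc n)"
    by (auto simp: P_gens_iff)
  then show ?thesis
    unfolding card_words_of_left_Suc unfolding P_gens_Suc_Suc by (simp add: finite_P_gens)
qed

section \<open>Matchings of the path and the recursion for \<open>H_coeff\<close>\<close>

lemma finite_path_edges: "finite (path_edges n)"
  by (simp add: path_edges_def setcompr_eq_image)

lemma finite_matchings: "finite Es \<Longrightarrow> finite (matchings Es j)"
  by (rule finite_subset[of _ "Pow Es"]) (auto simp: matchings_def)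

lemma num_matchings_0: "num_matchings n 0 = 1"
proof -
  have "matchings (path_edges n) 0 = {{}}"
    using finite_subset[OF _ finite_path_edges[of n]] by (auto simp: matchings_def disjoint_def)
  then show ?thesis by (simp add: num_matchings_def)
qed

lemma num_matchings_trivial: "n \<le> 1 \<Longrightarrow> num_matchings n (Suc j) = 0"
  by (auto simp: num_matchings_def matchings_def path_edges_def)

lemma num_matchings_rec:
  "num_matchings (Suc (Suc n)) (Suc j) = num_matchings (Suc n) (Suc j) + num_matchings n j"
proof -
  let ?e = "{Suc n, Suc (Suc n)}" and ?E = "path_edges"
  have edges: "?E (Suc (Suc n)) = insert ?e (?E (Suc n))"
    by (auto simp: path_edges_def le_Suc_eq)
  have mono: "?E n \<subseteq> ?E (Suc n)" by (auto simp: path_edges_def)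
  have far: "f \<inter> ?e = {}" if "f \<in> ?E n" for f using that by (auto simp: path_edges_def)
  have near: "f \<in> ?E n" if "f \<in> ?E (Suc n)" "f \<inter> ?e = {}" for f
    using that by (auto simp: path_edges_def)
  have e_notin: "?e \<notin> ?E (Suc n)" by (auto simp: path_edges_def doubleton_eq_iff)
  have "matchings (?E (Suc (Suc n))) (Suc j) =
      matchings (?E (Suc n)) (Suc j) \<union> insert ?e ` matchings (?E n) j"
  proof (intro equalityI subsetI)
    fix M assume M: "M \<in> matchings (?E (Suc (Suc n))) (Suc j)"
    show "M \<in> matchings (?E (Suc n)) (Suc j) \<union> insert ?e ` matchings (?E n) j"
    proof (cases "?e \<in> M")
      case True
      have "finite M" using M finite_subset[OF _ finite_path_edges] by (auto simp: matchings_def)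
      moreover have "M - {?e} \<subseteq> ?E n"
      proof
        fix f assume f: "f \<in> M - {?e}"
        with M True have "f \<inter> ?e = {}" "f \<in> ?E (Suc n)"
          using edges by (auto simp: matchings_def disjoint_def)
        then show "f \<in> ?E n" by (intro near)
      qed
      ultimately have "M - {?e} \<in> matchings (?E n) j"
        using M True by (auto simp: matchings_def disjoint_def)
      moreover have "M = insert ?e (M - {?e})" using True by blast
      ultimately show ?thesis by blast
    next
      case False
      with M show ?thesis unfolding edges by (auto simp: matchings_def)
    qed
  next
    fix M assume "M \<in> matchings (?E (Suc n)) (Suc j) \<union> insert ?e ` matchings (?E n) j"
    then consider "M \<in> matchings (?E (Suc n)) (Suc j)" | N where "N \<in> matchings (?E n) j" "M = insert ?e N"
      by blast
    then show "M \<in> matchings (?E (Suc (Suc n))) (Suc j)"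
    proof cases
      case 1
      then show ?thesis unfolding edges by (auto simp: matchings_def)
    next
      case 2
      then have N: "N \<subseteq> ?E n" "card N = j" "disjoint N" by (auto simp: matchings_def)
      moreover have "finite N" using N(1) finite_path_edges finite_subset by blast
      moreover have "?e \<notin> N" using N(1) mono e_notin by blast
      moreover have "disjoint (insert ?e N)"
        unfolding disjoint_def using N(1,3) far by (fastforce simp: disjoint_def)
      ultimately show ?thesis using 2(2) mono unfolding edges by (auto simp: matchings_def)
    qed
  qed
  moreover have "matchings (?E (Suc n)) (Suc j) \<inter> insert ?e ` matchings (?E n) j = {}"
    using e_notin by (auto simp: matchings_def)
  moreover have "inj_on (insert ?e) (matchings (?E n) j)"
  proof (rule inj_onI)
    fix M N assume "M \<in> matchings (?E n) j" "N \<in> matchings (?E n) j" and eq: "insert ?e M = insert ?e N"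
    then have "?e \<notin> M" "?e \<notin> N" using mono e_notin by (auto simp: matchings_def)
    with eq show "M = N" using insert_ident by metis
  qed
  ultimately show ?thesis
    by (simp add: num_matchings_def card_Un_disjoint card_image finite_matchings finite_path_edges)
qed

text \<open>This makes the truncated subtraction \<open>n - 2 * j\<close> harmless in
  \<open>H_coeff_rec\<close>.\<close>

lemma num_matchings_eq_0: "n < 2 * j \<Longrightarrow> num_matchings n j = 0"
proof (induction n arbitrary: j rule: less_induct)
  case (less n)
  then obtain k where k: "j = Suc k" by (cases j) auto
  show ?case
  proof (cases "n \<le> 1")
    case False
    then obtain m where m: "n = Suc (Suc m)" by (metis One_nat_def Suc_le_mono le0 not_less_eq_eq old.nat.exhaust)
    with k less.prems have "num_matchings (Suc m) j = 0" "num_matchings m k = 0"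
      by (auto intro!: less.IH)
    then show ?thesis by (simp add: m k num_matchings_rec)
  qed (simp add: k num_matchings_trivial)
qed

lemma H_coeff_rec:
  "H_coeff (Suc (Suc n)) (Suc i) = H_coeff (Suc n) (Suc i) + H_coeff (Suc n) i + H_coeff n i"
proof -
  \<comment> \<open>The matchings avoiding the last edge, still with the binomial coefficient of the
    longer path, to be split by Pascal's rule. Those using the edge give \<open>H_coeff n i\<close>
    after a shift of \<open>j\<close>.\<close>
  let ?t = "\<lambda>j. num_matchings (Suc n) j * ((Suc (Suc n) - 2 * j) choose (Suc i - j))"
  have "H_coeff (Suc (Suc n)) (Suc i) = (\<Sum>j\<le>Suc i. ?t j) + H_coeff n i"
    unfolding H_coeff_def sum.atMost_Suc_shift
    by (simp add: num_matchings_0 num_matchings_rec algebra_simps sum.distrib)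
  moreover have "(\<Sum>j\<le>Suc i. ?t j) = H_coeff (Suc n) (Suc i) + H_coeff (Suc n) i"
  proof -
    have "?t j = num_matchings (Suc n) j * ((Suc n - 2 * j) choose (Suc i - j))
        + num_matchings (Suc n) j * ((Suc n - 2 * j) choose (i - j))" if "j \<le> i" for j
    \<comment> \<open>Pascal's rule applies when the upper entry is a successor; in the other case
      there are no matchings of size \<open>j\<close>.\<close>
    proof (cases "Suc n < 2 * j")
      case False
      then have "Suc (Suc n) - 2 * j = Suc (Suc n - 2 * j)" by simp
      with that show ?thesis by (simp add: Suc_diff_le algebra_simps)
    qed (simp add: num_matchings_eq_0)
    then show ?thesis by (simp add: H_coeff_def sum.distrib)
  qed
  ultimately show ?thesis by simp
qed

text \<open>Both numbers satisfy the same recursion and agree for \<open>i = 0\<close> and for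
  \<open>n \<le> 1\<close>.\<close>

theorem card_words_of_left: "card (words_of (P_gens n) left i) = H_coeff n i"
proof (induction n arbitrary: i rule: less_induct)
  case (less n)
  show ?case
  proof (cases i)
    case 0
    have "words_of (P_gens n) left 0 = {[]}" by (auto simp: words_of_def)
    then show ?thesis by (simp add: 0 H_coeff_def num_matchings_0)
  next
    case (Suc k)
    consider "n = 0" | "n = Suc 0" | m where "n = Suc (Suc m)"
      by (metis old.nat.exhaust)
    then show ?thesis
    proof cases
      case 1
      have "P_gens 0 = {}" by (simp add: P_gens_def)
      then show ?thesis
        unfolding 1 Suc card_words_of_left_Suc H_coeff_def sum.atMost_Suc_shift
        by (simp add: num_matchings_trivial)
    next
      case 2
      have P1: "P_gens (Suc 0) = {Vg (Suc 0)}" by (simp add: P_gens_def)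
      have "card (words_of (P_gens 0) left k) = (if k = 0 then 1 else 0)"
      proof -
        have "words_of (P_gens 0) left k = (if k = 0 then {[]} else {})"
          by (auto simp: words_of_def P_gens_def)
        then show ?thesis by simp
      qed
      moreover have "card (words_of (P_gens (Suc 0)) left (Suc k)) = card (words_of (P_gens 0) left k)"
        unfolding card_words_of_left_Suc unfolding P1 by simp
      ultimately show ?thesis
        unfolding 2 Suc H_coeff_def sum.atMost_Suc_shift
        by (simp add: num_matchings_trivial num_matchings_0)
    next
      case 3
      then show ?thesis by (simp add: Suc card_words_of_left_rec H_coeff_rec less.IH)
    qed
  qed
qed

lemma H_series_eq: "H_series n = Abs_fps (\<lambda>i. of_nat (card (words_of (P_gens n) left i)))"
  by (simp add: H_series_def card_words_of_left)


section \<open>The dual of \<open>ch(P\<^sub>n)\<close>\<close>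

text \<open>Twice the midpoint, which orders the generators as \<open>Vg 1\<close>,
  \<open>Eg 1\<close>, \<open>Vg 2\<close>, \<open>Eg 2\<close> and so on. Besides refining
  \<open>left\<close>, it puts \<open>Eg i\<close> below \<open>Vg (i + 1)\<close>, as the terms of
  \<open>corr\<close> require.\<close>

definition rank :: "gen \<Rightarrow> nat" where "rank x = lo x + hi x"

lemma left_rank: "left x y \<Longrightarrow> rank x < rank y"
  using lo_le_hi[of x] lo_le_hi[of y] by (auto simp: left_def rank_def)

lemma var_mult_var: "var a * var b = word [a, b]"
  by (simp add: var_eq_word word_mult)

definition dual_red :: "nat \<Rightarrow> gen \<Rightarrow> gen \<Rightarrow> bool"
  where "dual_red n a b \<longleftrightarrow> a \<in> P_gens n \<and> b \<in> P_gens n \<and> \<not> left a b"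

text \<open>The value \<open>0\<close> covers generators that meet, including \<open>a = b\<close>:
  such a word pairs to zero with every commutator in \<open>ch_rels\<close>.\<close>

definition dual_rhs :: "gen \<Rightarrow> gen \<Rightarrow> (gen, 'f::field) ncpoly"
  where "dual_rhs a b = (if left b a then - (var b * var a) else 0)"

lemma quadratic_pairing_commutator:
  assumes "finite X" "s \<in> X" "t \<in> X"
  shows "quadratic_pairing X q (commutator (var s) (var t)) = Poly_Mapping.lookup q [s, t] - Poly_Mapping.lookup q [t, s]"
proof -
  have delta: "(\<Sum>x\<in>X. \<Sum>y\<in>X. Poly_Mapping.lookup q [x, y] * Poly_Mapping.lookup (word [a, b]) [x, y]) = Poly_Mapping.lookup q [a, b]"
    if "a \<in> X" "b \<in> X" for a b
  proof -
    have "(\<Sum>y\<in>X. Poly_Mapping.lookup q [x, y] * Poly_Mapping.lookup (word [a, b]) [x, y]) =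
        (if x = a then Poly_Mapping.lookup q [a, b] else 0)" for x
      using that assms(1) by (auto simp: lookup_single when_def if_distrib cong: if_cong)
    then show ?thesis using that assms(1) by simp
  qed
  show ?thesis
    by (simp add: quadratic_pairing_def commutator_def var_mult_var lookup_minus right_diff_distrib
      sum_subtractf delta assms)
qed

text \<open>Up to sign and zeros, \<open>ch_rels\<close> consists of the commutators of disjoint
  generators, and pairing with a commutator gives the difference of two mirrored
  coefficients.\<close>

lemma dual_relations_ch_iff:
  "q \<in> dual_relations (P_gens n) (ch_rels n) \<longleftrightarrow> q \<in> homogeneous (P_gens n) 2 \<and>
    (\<forall>s\<in>P_gens n. \<forall>t\<in>P_gens n. left s t \<longrightarrow> Poly_Mapping.lookup q [s, t] = Poly_Mapping.lookup q [t, s])"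
proof -
  let ?X = "P_gens n" and ?l = "\<lambda>s t. Poly_Mapping.lookup q [s, t]"
  note pairing = quadratic_pairing_commutator[OF finite_P_gens]
  have "(\<forall>r\<in>ch_rels n. quadratic_pairing ?X q r = 0) \<longleftrightarrow> (\<forall>s\<in>?X. \<forall>t\<in>?X. left s t \<longrightarrow> ?l s t = ?l t s)"
  proof (intro iffI ballI impI)
    fix s t assume ch: "\<forall>r\<in>ch_rels n. quadratic_pairing ?X q r = 0" and st: "s \<in> ?X" "t \<in> ?X" "left s t"
    have "commutator (var s) (var t) \<in> ch_rels n \<or> commutator (var t) (var s) \<in> ch_rels n"
    proof (cases s; cases t)
      fix i j assume "s = Vg i" "t = Vg j"
      moreover from this have "i \<in> {1..n}" "j \<in> {1..n}" using st by (auto simp: P_gens_def)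
      ultimately show ?thesis unfolding ch_rels_def by blast
    next
      fix i j assume ij: "s = Vg i" "t = Eg j"
      have "j \<in> {1..n - 1}" using st ij by (auto simp: P_gens_def)
      moreover have "s \<in> P_gens n - {Eg (j - 1), Eg (j + 1), Vg j, Vg (j + 1)}"
        using st ij by (simp add: left_def)
      ultimately show ?thesis unfolding ch_rels_def ij by blast
    next
      fix i j assume ij: "s = Eg i" "t = Vg j"
      have "i \<in> {1..n - 1}" using st ij by (auto simp: P_gens_def)
      moreover have "t \<in> P_gens n - {Eg (i - 1), Eg (i + 1), Vg i, Vg (i + 1)}"
        using st ij by (simp add: left_def)
      ultimately show ?thesis unfolding ch_rels_def ij by blast
    next
      fix i j assume ij: "s = Eg i" "t = Eg j"
      have "i \<in> {1..n - 1}" using st ij by (auto simp: P_gens_def)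
      moreover have "t \<in> P_gens n - {Eg (i - 1), Eg (i + 1), Vg i, Vg (i + 1)}"
        using st ij by (auto simp: left_def)
      ultimately show ?thesis unfolding ch_rels_def ij by blast
    qed
    with ch show "?l s t = ?l t s"
      using pairing[OF st(1,2), of q] pairing[OF st(2,1), of q] by auto
  next
    fix r :: "(gen, 'a) ncpoly"
    assume sym: "\<forall>s\<in>?X. \<forall>t\<in>?X. left s t \<longrightarrow> ?l s t = ?l t s" and "r \<in> ch_rels n"
    \<comment> \<open>The case \<open>s = t\<close> occurs because both families contain commutators
      of a generator with itself, which vanish.\<close>
    then obtain s t where r: "r = commutator (var s) (var t)" "s \<in> ?X" "t \<in> ?X" "left s t \<or> left t s \<or> s = t"
    proof -
      from \<open>r \<in> ch_rels n\<close> consider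
          i j where "r = commutator (vv i) (vv j)" "i \<in> {1..n}" "j \<in> {1..n}"
        | i g where "r = commutator (ee i) (var g)" "i \<in> {1..n - 1}" "g \<in> ?X - {Eg (i - 1), Eg (i + 1), Vg i, Vg (i + 1)}"
        unfolding ch_rels_def by blast
      then show thesis
      proof cases
        case 1
        then show thesis by (intro that[of "Vg i" "Vg j"]) (auto simp: left_def P_gens_def)
      next
        case 2
        then have "left (Eg i) g \<or> left g (Eg i) \<or> Eg i = g"
          by (cases g; simp add: left_def; arith)
        with 2 show thesis by (intro that[of "Eg i" g]) (auto simp: P_gens_def)
      qed
    qed
    then show "quadratic_pairing ?X q r = 0"
      using sym pairing[OF r(2,3), of q] by auto
  qed
  then show ?thesis by (auto simp: dual_relations_def)
qed

lemma homogeneous_2_expansion: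
  assumes "finite X" "q \<in> homogeneous X 2" "lin G"
  shows "G q = (\<Sum>(x, y)\<in>X \<times> X. scalar_poly (Poly_Mapping.lookup q [x, y]) * G (var x * var y))"
proof -
  let ?f = "\<lambda>w. scalar_poly (Poly_Mapping.lookup q w) * G (word w)"
  have inj: "inj_on (\<lambda>(x, y). [x, y]) (X \<times> X)" by (auto simp: inj_on_def)
  have "Poly_Mapping.keys q \<subseteq> (\<lambda>(x, y). [x, y]) ` (X \<times> X)"
  proof
    fix w assume "w \<in> Poly_Mapping.keys q"
    with assms(2) have "w \<in> lists X" "length w = Suc (Suc 0)" by (auto simp: homogeneous_def)
    then show "w \<in> (\<lambda>(x, y). [x, y]) ` (X \<times> X)"
      by (auto simp: length_Suc_conv)
  qed
  then have "G q = sum ?f ((\<lambda>(x, y). [x, y]) ` (X \<times> X))"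
    unfolding lin_expansion[OF assms(3), of q]
    using assms(1) by (intro sum.mono_neutral_left) (auto simp: in_keys_iff)
  then show ?thesis
    unfolding sum.reindex[OF inj] by (simp add: case_prod_unfold var_mult_var)
qed

lemma dual_quadratic_rewriting:
  "quadratic_rewriting (P_gens n) (dual_relations (P_gens n) (ch_rels n :: (gen, 'f::field) ncpoly set))
    rank (dual_red n) dual_rhs"
proof
  let ?X = "P_gens n"
  show "finite ?X" by (rule finite_P_gens)
  show "\<exists>c d. w = [c, d] \<and> c \<in> ?X \<and> d \<in> ?X \<and> rank c < rank a"
    if "dual_red n a b" "w \<in> Poly_Mapping.keys (dual_rhs a b :: (gen, 'f) ncpoly)" for a b w
    using that by (auto simp: dual_red_def dual_rhs_def var_mult_var left_rank split: if_splits)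
  show "dual_relations ?X (ch_rels n) \<subseteq> carrier (free_algebra ?X)"
    by (auto simp: dual_relations_def homogeneous_def)
  show "var a * var b - dual_rhs a b \<in> dual_relations ?X (ch_rels n :: (gen, 'f) ncpoly set) \<or>
      dual_rhs a b - var a * var b \<in> dual_relations ?X (ch_rels n)" if "dual_red n a b" for a b
  proof
    have "Poly_Mapping.keys (var a * var b - dual_rhs a b :: (gen, 'f) ncpoly) \<subseteq> {w \<in> lists ?X. length w = 2}"
      using that by (intro keys_diff_subset) (auto simp: dual_red_def dual_rhs_def var_mult_var)
    \<comment> \<open>The element is \<open>a b + b a\<close>, which is symmetric, or
      \<open>a b\<close> for a meeting pair, which has no coefficient at disjoint pairs.\<close>
    moreover have "Poly_Mapping.lookup (var a * var b - dual_rhs a b :: (gen, 'f) ncpoly) [s, t] =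
        Poly_Mapping.lookup (var a * var b - dual_rhs a b) [t, s]" if "left s t" for s t
    proof (cases "s = b \<and> t = a")
      case True
      with \<open>left s t\<close> have "left b a" "a \<noteq> b" using left_irrefl by auto
      with True show ?thesis
        by (simp add: dual_rhs_def var_mult_var lookup_add lookup_single)
    next
      case False
      with \<open>left s t\<close> \<open>dual_red n a b\<close> have "[a, b] \<noteq> [s, t]" "[b, a] \<noteq> [s, t]" "[a, b] \<noteq> [t, s]" "[b, a] \<noteq> [t, s]"
        by (auto simp: dual_red_def)
      then show ?thesis
        by (simp add: dual_rhs_def var_mult_var lookup_add lookup_minus lookup_single_not_eq)
    qed
    ultimately show "var a * var b - dual_rhs a b \<in> dual_relations ?X (ch_rels n :: (gen, 'f) ncpoly set)"
      unfolding dual_relations_ch_iff homogeneous_def by blast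
  qed
next
  fix G :: "(gen, 'f) ncpoly \<Rightarrow> (gen, 'f) ncpoly" and r :: "(gen, 'f) ncpoly"
  let ?X = "P_gens n"
  assume G: "lin G" and red: "\<And>a b. dual_red n a b \<Longrightarrow> G (var a * var b) = G (dual_rhs a b)"
    and r: "r \<in> dual_relations ?X (ch_rels n)"
  let ?h = "\<lambda>(x, y). scalar_poly (Poly_Mapping.lookup r [x, y]) * G (var x * var y)"
  let ?L = "{(x, y) \<in> ?X \<times> ?X. left x y}" and ?L' = "{(x, y) \<in> ?X \<times> ?X. left y x}"
  have fin: "finite (?X \<times> ?X)" by (simp add: finite_P_gens)
  \<comment> \<open>Mirrored coefficients of \<open>r\<close> agree while \<open>G\<close> turns
    \<open>y x\<close> into \<open>- x y\<close>, so the two words of a disjoint pair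
    cancel.\<close>
  have neg: "?h (y, x) = - ?h (x, y)" if "x \<in> ?X" "y \<in> ?X" "left x y" for x y
  proof -
    have "Poly_Mapping.lookup r [y, x] = Poly_Mapping.lookup r [x, y]"
      using r that unfolding dual_relations_ch_iff by metis
    with that show ?thesis
      using red[of y x] left_asym[of x y] by (simp add: dual_red_def dual_rhs_def lin_uminus[OF G])
  qed
  have "G r = sum ?h (?X \<times> ?X)"
    using r by (intro homogeneous_2_expansion[OF finite_P_gens _ G]) (simp add: dual_relations_def)
  also have "\<dots> = sum ?h (?L \<union> ?L')"
  proof (rule sum.mono_neutral_right[OF fin])
    show "\<forall>p\<in>?X \<times> ?X - (?L \<union> ?L'). ?h p = 0"
    proof
      fix p assume "p \<in> ?X \<times> ?X - (?L \<union> ?L')"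
      then obtain x y where "p = (x, y)" "dual_red n x y" "\<not> left y x" by (auto simp: dual_red_def)
      with red[of x y] show "?h p = 0" by (simp add: dual_rhs_def lin_0[OF G])
    qed
  qed auto
  also have "\<dots> = sum ?h ?L + sum ?h ?L'"
    using left_asym by (intro sum.union_disjoint finite_subset[OF _ fin]) auto
  also have "sum ?h ?L' = (\<Sum>(x, y)\<in>?L. ?h (y, x))"
    by (rule sum.reindex_bij_witness[of _ prod.swap prod.swap]) auto
  also have "\<dots> = - sum ?h ?L"
    unfolding sum_negf[symmetric] using neg by (intro sum.cong) auto
  finally show "G r = 0" by simp
next
  fix G :: "(gen, 'f) ncpoly \<Rightarrow> (gen, 'f) ncpoly" and z y x
  assume G: "lin G" and zy: "dual_red n z y" and yx: "dual_red n y x"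
    and H1: "\<And>a b c. dual_red n a b \<Longrightarrow> rank a < rank z \<or> a = z \<and> rank b < rank y \<Longrightarrow>
        G (var a * var b * var c) = G (dual_rhs a b * var c)"
    and H2: "\<And>a b c. dual_red n b c \<Longrightarrow> rank a < rank z \<or> a = z \<and> rank b < rank y \<Longrightarrow>
        G (var a * var b * var c) = G (var a * dual_rhs b c)"
  have X: "x \<in> P_gens n" "y \<in> P_gens n" "z \<in> P_gens n" using zy yx by (auto simp: dual_red_def)
  note neg = lin_uminus[OF G] and zero = lin_0[OF G]
  show "G (dual_rhs z y * var x) = G (var z * dual_rhs y x)"
  proof (cases "left y z"; cases "left x y")
    assume l: "left y z" "left x y"
    then have l': "left x z" using left_trans by blast
    have red: "dual_red n z x" "dual_red n y x" "dual_red n z y"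
      using X l l' left_asym by (auto simp: dual_red_def)
    \<comment> \<open>For pairwise disjoint generators both routes to \<open>x y z\<close> use three
      transpositions, hence have the same sign.\<close>
    have "G (var y * var z * var x) = G (var x * var y * var z)"
      using H2[of z x y] H1[of y x z] red l l' left_rank[OF l(1)]
      by (simp add: dual_rhs_def neg mult.assoc)
    moreover have "G (var z * var x * var y) = G (var x * var y * var z)"
      using H1[of z x y] H2[of z y x] red l l' left_rank[OF l(2)] left_rank[OF l']
      by (simp add: dual_rhs_def neg mult.assoc)
    ultimately show ?thesis using l by (simp add: dual_rhs_def neg mult.assoc)
  next
    assume l: "left y z" "\<not> left x y"
    \<comment> \<open>\<open>left z x\<close> would give \<open>left y x\<close>. So
      \<open>z x\<close> vanishes or is swapped, and then the vanishing pair \<open>y x\<close>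
      appears.\<close>
    then have "dual_red n z x" using X yx left_trans by (auto simp: dual_red_def)
    then have "G (var y * var z * var x) = 0"
      using H2[of z x y] H1[of y x z] yx l left_rank[OF l(1)]
      by (simp add: dual_rhs_def neg zero mult.assoc split: if_splits)
    then show ?thesis using l by (simp add: dual_rhs_def neg zero)
  next
    assume l: "\<not> left y z" "left x y"
    then have "dual_red n z x" using X zy left_trans by (auto simp: dual_red_def)
    then have "G (var z * var x * var y) = 0"
      using H1[of z x y] H2[of z y x] zy l left_rank[OF l(2)] left_rank[of x z]
      by (simp add: dual_rhs_def neg zero mult.assoc split: if_splits)
    then show ?thesis using l by (simp add: dual_rhs_def neg zero mult.assoc)
  next
    assume "\<not> left y z" "\<not> left x y"
    then show ?thesis by (simp add: dual_rhs_def)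
  qed
qed

text \<open>The irreducible pairs are those with \<open>left a b\<close>, so the normal words are
  the chains counted by \<open>card_words_of_left\<close>.\<close>

theorem hilbert_series_dual:
  "hilbert_series (P_gens n) (dual_relations (P_gens n) (ch_rels n :: (gen, 'f::field) ncpoly set)) = H_series n"
proof -
  interpret quadratic_rewriting "P_gens n" "dual_relations (P_gens n) (ch_rels n :: (gen, 'f) ncpoly set)"
      rank "dual_red n" dual_rhs
    by (rule dual_quadratic_rewriting)
  have "{w \<in> lists (P_gens n). length w = i \<and> normal w} = words_of (P_gens n) left i" for i
    unfolding words_of_def normal_def
    by (intro Collect_cong conj_cong refl successively_cong) (auto simp: dual_red_def)
  then show ?thesis by (simp add: hilbert_series_eq H_series_eq)
qed


section \<open>The algebra \<open>P\<^sub>n\<close>\<close>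

text \<open>For \<open>x\<close> to the left of \<open>y\<close>, the relation of \<open>P\<^sub>n\<close> between them reads \<open>y x = x y + corr x y\<close>.\<close>

fun corr :: "gen \<Rightarrow> gen \<Rightarrow> (gen, 'f::field) ncpoly" where
  "corr (Vg i) (Vg j) = (if j = i + 1 then ee i * vv j - ee i * vv i else 0)"
| "corr (Vg i) (Eg j) = (if j = i + 1 then ee i * ee j else 0)"
| "corr (Eg i) (Vg j) = (if j = i + 2 then - (ee (i + 1) * ee i) else 0)"
| "corr (Eg i) (Eg j) = 0"

definition P_red :: "nat \<Rightarrow> gen \<Rightarrow> gen \<Rightarrow> bool"
  where "P_red n a b \<longleftrightarrow> a \<in> P_gens n \<and> b \<in> P_gens n \<and> left b a"

definition P_rhs :: "gen \<Rightarrow> gen \<Rightarrow> (gen, 'f::field) ncpoly"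
  where "P_rhs a b = var b * var a + corr b a"

text \<open>Every correction word begins with the edge ending at \<open>lo a\<close>, whose rank is
  below that of \<open>a\<close>.\<close>

lemma corr_keys:
  assumes "P_red n a b" "w \<in> Poly_Mapping.keys (corr b a :: (gen, 'f::field) ncpoly)"
  shows "\<exists>c d. w = [c, d] \<and> c \<in> P_gens n \<and> d \<in> P_gens n \<and> rank c < rank a"
proof (cases b; cases a)
  fix i j assume ab: "b = Vg i" "a = Vg j"
  with assms have "j = i + 1" "w \<in> Poly_Mapping.keys (word [Eg i, Vg j] - word [Eg i, Vg i] :: (gen, 'f) ncpoly)"
    by (auto simp: var_mult_var split: if_splits)
  moreover from this have "w \<in> {[Eg i, Vg j], [Eg i, Vg i]}"
    using keys_diff_subset[of "word [Eg i, Vg j] :: (gen, 'f) ncpoly" "{[Eg i, Vg j], [Eg i, Vg i]}" "word [Eg i, Vg i]"] by auto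
  ultimately show ?thesis using assms(1) ab by (auto simp: P_red_def P_gens_iff rank_def)
next
  fix i j assume ab: "b = Vg i" "a = Eg j"
  with assms show ?thesis by (auto simp: var_mult_var P_red_def P_gens_iff rank_def split: if_splits)
next
  fix i j assume ab: "b = Eg i" "a = Vg j"
  with assms show ?thesis by (auto simp: var_mult_var P_red_def P_gens_iff rank_def split: if_splits)
next
  fix i j assume ab: "b = Eg i" "a = Eg j"
  with assms show ?thesis by simp
qed

text \<open>The sign depends on whether the commutator in the relation begins with the left or the
  right generator. The converse is \<open>P_rule_in_P_rels\<close>.\<close>

lemma P_rels_cases:
  assumes "r \<in> P_rels n"
  obtains a b where "P_red n a b" "r = var a * var b - P_rhs a b \<or> r = P_rhs a b - var a * var b"
proof -
  note simps = P_red_def P_gens_def left_def P_rhs_def commutator_def right_diff_distrib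
  from assms consider
      i j where "i \<in> {1..n}" "j \<in> {1..n}" "j > i + 1" "r = commutator (vv i) (vv j)"
    | i where "i \<in> {1..n - 1}" "r = commutator (vv i) (vv (i + 1)) + ee i * (vv (i + 1) - vv i)"
    | i j where "i \<in> {1..n - 1}" "j \<in> {1..n - 1}" "j > i + 1" "r = commutator (ee i) (ee j)"
    | i j where "i \<in> {1..n}" "j \<in> {1..n - 1}" "j > i + 1" "r = commutator (vv i) (ee j)"
    | i j where "i \<in> {1..n}" "j \<in> {1..n - 1}" "j + 2 < i" "r = commutator (vv i) (ee j)"
    | i where "i \<in> {1..n - 2}" "r = commutator (vv i) (ee (i + 1)) + ee i * ee (i + 1)"
    | i where "i \<in> {1..n - 2}" "r = commutator (vv (i + 2)) (ee i) + ee (i + 1) * ee i"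
    unfolding P_rels_def by blast
  then show thesis
  proof cases
    case (1 i j)
    then show thesis by (intro that[of "Vg j" "Vg i"]) (auto simp: simps)
  next
    case (2 i)
    then show thesis by (intro that[of "Vg (i + 1)" "Vg i"]) (auto simp: simps)
  next
    case (3 i j)
    then show thesis by (intro that[of "Eg j" "Eg i"]) (auto simp: simps)
  next
    case (4 i j)
    then show thesis by (intro that[of "Eg j" "Vg i"]) (auto simp: simps)
  next
    case (5 i j)
    then show thesis by (intro that[of "Vg i" "Eg j"]) (auto simp: simps)
  next
    case (6 i)
    then show thesis by (intro that[of "Eg (i + 1)" "Vg i"]) (auto simp: simps)
  next
    case (7 i)
    then show thesis by (intro that[of "Vg (i + 2)" "Eg i"]) (auto simp: simps)
  qed
qed

lemma P_rule_in_P_rels: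
  assumes "P_red n a b"
  shows "var a * var b - P_rhs a b \<in> P_rels n \<or> P_rhs a b - var a * var b \<in> P_rels n"
proof (cases b; cases a)
  fix i j assume ab: "b = Vg i" "a = Vg j"
  with assms have ij: "i \<in> {1..n}" "j \<in> {1..n}" "i < j" by (auto simp: P_red_def P_gens_def left_def)
  show ?thesis
  proof (cases "j = i + 1")
    case True
    then have "P_rhs a b - var a * var b = commutator (vv i) (vv (i + 1)) + ee i * (vv (i + 1) - vv i)"
      using ab by (simp add: P_rhs_def commutator_def right_diff_distrib)
    moreover have "i \<in> {1..n - 1}" using ij True by auto
    ultimately show ?thesis unfolding P_rels_def by blast
  next
    case False
    then have "P_rhs a b - var a * var b = commutator (vv i) (vv j)"
      using ab by (simp add: P_rhs_def commutator_def)
    moreover have "j > i + 1" using ij False by auto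
    ultimately show ?thesis unfolding P_rels_def using ij by blast
  qed
next
  fix i j assume ab: "b = Vg i" "a = Eg j"
  with assms have ij: "i \<in> {1..n}" "j \<in> {1..n - 1}" "i < j" by (auto simp: P_red_def P_gens_def left_def)
  show ?thesis
  proof (cases "j = i + 1")
    case True
    then have "P_rhs a b - var a * var b = commutator (vv i) (ee (i + 1)) + ee i * ee (i + 1)"
      using ab by (simp add: P_rhs_def commutator_def)
    moreover have "i \<in> {1..n - 2}" using ij True by auto
    ultimately show ?thesis unfolding P_rels_def by blast
  next
    case False
    then have "P_rhs a b - var a * var b = commutator (vv i) (ee j)"
      using ab by (simp add: P_rhs_def commutator_def)
    moreover have "j > i + 1" using ij False by auto
    ultimately show ?thesis unfolding P_rels_def using ij by blast
  qed
next
  fix i j assume ab: "b = Eg i" "a = Vg j"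
  with assms have ij: "i \<in> {1..n - 1}" "j \<in> {1..n}" "i + 1 < j" by (auto simp: P_red_def P_gens_def left_def)
  show ?thesis
  proof (cases "j = i + 2")
    case True
    then have "var a * var b - P_rhs a b = commutator (vv (i + 2)) (ee i) + ee (i + 1) * ee i"
      using ab by (simp add: P_rhs_def commutator_def)
    moreover have "i \<in> {1..n - 2}" using ij True by auto
    ultimately show ?thesis unfolding P_rels_def by blast
  next
    case False
    then have "var a * var b - P_rhs a b = commutator (vv j) (ee i)"
      using ab by (simp add: P_rhs_def commutator_def)
    moreover have "i + 2 < j" using ij False by auto
    ultimately show ?thesis unfolding P_rels_def using ij by blast
  qed
next
  fix i j assume ab: "b = Eg i" "a = Eg j"
  with assms have ij: "i \<in> {1..n - 1}" "j \<in> {1..n - 1}" "j > i + 1" by (auto simp: P_red_def P_gens_def left_def)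
  have "P_rhs a b - var a * var b = commutator (ee i) (ee j)"
    using ab by (simp add: P_rhs_def commutator_def)
  then show ?thesis unfolding P_rels_def using ij by blast
qed

text \<open>A correction requires \<open>lo z = hi x + 1\<close>, and an interval in between forces
  a larger gap.\<close>

lemma corr_between: "left x y \<Longrightarrow> left y z \<Longrightarrow> corr x z = 0"
  using lo_le_hi[of y] by (cases x; cases z) (auto simp: left_def)

text \<open>Sorting \<open>z y x\<close> in either way gives \<open>x y z\<close> plus corrections
  from \<open>x y\<close> and \<open>y z\<close>; the pair \<open>x z\<close> contributes none by
  \<open>corr_between\<close>. What remains is the identity \<open>key\<close>.\<close>

lemma P_overlap:
  fixes G :: "(gen, 'f::field) ncpoly \<Rightarrow> (gen, 'f) ncpoly"
  assumes G: "lin G" and zy: "P_red n z y" and yx: "P_red n y x"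
    and H1: "\<And>a b c. P_red n a b \<Longrightarrow> rank a < rank z \<or> a = z \<and> rank b < rank y \<Longrightarrow>
        G (var a * var b * var c) = G (P_rhs a b * var c)"
    and H2: "\<And>a b c. P_red n b c \<Longrightarrow> rank a < rank z \<or> a = z \<and> rank b < rank y \<Longrightarrow>
        G (var a * var b * var c) = G (var a * P_rhs b c)"
  shows "G (P_rhs z y * var x) = G (var z * P_rhs y x)"
proof -
  have X: "x \<in> P_gens n" "y \<in> P_gens n" "z \<in> P_gens n" and l: "left x y" "left y z"
    using zy yx by (auto simp: P_red_def)
  then have xz: "left x z" using left_trans by blast
  note ranks = left_rank[OF l(1)] left_rank[OF l(2)]
  note lin = lin_add[OF G] lin_diff[OF G] lin_uminus[OF G] lin_0[OF G]
  \<comment> \<open>The sorting moves that \<open>H1\<close> and \<open>H2\<close> permit: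
    \<open>M1\<close> carries \<open>z\<close> to the end, \<open>M2\<close> carries
    \<open>x\<close> to the front, \<open>M3\<close> swaps the first two letters.\<close>
  have M1: "G (var z * (var p * var q)) = G (var p * (var q * var z)) + G (corr p z * var q) + G (var p * corr q z)"
    if "left p z" "left q z" "p \<in> P_gens n" "q \<in> P_gens n" "rank p < rank y" for p q
    using H1[of z p q] H2[of z q p] that X left_rank[OF that(1)]
    by (simp add: P_red_def P_rhs_def algebra_simps lin)
  have M2: "G (var p * (var q * var x)) = G (var x * (var p * var q)) + G (var p * corr x q) + G (corr x p * var q)"
    if "left x p" "left x q" "p \<in> P_gens n" "q \<in> P_gens n" "rank p < rank z" for p q
    using H2[of q x p] H1[of p x q] that X
    by (simp add: P_red_def P_rhs_def algebra_simps lin)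
  have M3: "G (var p * (var q * var r)) = G (var q * (var p * var r)) + G (corr q p * var r)"
    if "left q p" "p \<in> P_gens n" "q \<in> P_gens n" "rank p < rank z" for p q r
    using H1[of p q r] that by (simp add: P_red_def P_rhs_def algebra_simps lin)
  \<comment> \<open>If only one of the pairs \<open>x y\<close>, \<open>y z\<close> has a
    correction, the third generator commutes past it. If both have one, the secondary corrections on
    the two sides match.\<close>
  have key: "G (corr x y * var z) + G (corr y z * var x) = G (var x * corr y z) + G (var z * corr x y)"
  proof (cases x; cases y; cases z)
    fix i j k assume c: "x = Vg i" "y = Vg j" "z = Vg k"
    note simps = c M1[unfolded c] M2[unfolded c] M3[unfolded c] lin P_gens_iff left_def rank_def algebra_simps
    consider "j \<noteq> i + 1" "k \<noteq> j + 1" | "j \<noteq> i + 1" "k = j + 1" | "j = i + 1" "k \<noteq> j + 1" | "j = i + 1" "k = j + 1"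
      by blast
    then show ?thesis
    proof cases
      case 1
      with l X ranks show ?thesis by (simp add: simps)
    next
      case 2
      with l X ranks show ?thesis by (simp add: simps)
    next
      case 3
      with l X ranks show ?thesis by (simp add: simps)
    next
      case 4
      with c have c': "x = Vg i" "y = Vg (Suc i)" "z = Vg (Suc (Suc i))" by simp_all
      \<comment> \<open>Only \<open>z\<close> before \<open>corr x y\<close> and \<open>x\<close>
        behind \<open>corr y z\<close> are out of place; the four instances sort the resulting
        words.\<close>
      from X show ?thesis
        by (simp add: c' M1[of "Eg i" "Vg i", unfolded c'] M1[of "Eg i" "Vg (Suc i)", unfolded c']
          M2[of "Eg (Suc i)" "Vg (Suc (Suc i))", unfolded c'] M2[of "Eg (Suc i)" "Vg (Suc i)", unfolded c']
          lin P_gens_iff left_def rank_def algebra_simps)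
    qed
  next
    fix i j k assume c: "x = Vg i" "y = Vg j" "z = Eg k"
    note simps = c M1[unfolded c] M2[unfolded c] M3[unfolded c] lin P_gens_iff left_def rank_def algebra_simps
    consider "j \<noteq> i + 1" "k \<noteq> j + 1" | "j \<noteq> i + 1" "k = j + 1" | "j = i + 1" "k \<noteq> j + 1" | "j = i + 1" "k = j + 1"
      by blast
    then show ?thesis
    proof cases
      case 1
      with l X ranks show ?thesis by (simp add: simps)
    next
      case 2
      with l X ranks show ?thesis by (simp add: simps)
    next
      case 3
      with l X ranks show ?thesis by (simp add: simps)
    next
      case 4
      with c have c': "x = Vg i" "y = Vg (Suc i)" "z = Eg (Suc (Suc i))" by simp_all
      from X show ?thesis
        by (simp add: c' M1[unfolded c'] M2[unfolded c'] M3[unfolded c'] lin P_gens_iff left_def rank_def algebra_simps)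
    qed
  next
    fix i j k assume c: "x = Vg i" "y = Eg j" "z = Vg k"
    note simps = c M1[unfolded c] M2[unfolded c] M3[unfolded c] lin P_gens_iff left_def rank_def algebra_simps
    consider "j \<noteq> i + 1" "k \<noteq> j + 2" | "j \<noteq> i + 1" "k = j + 2" | "j = i + 1" "k \<noteq> j + 2" | "j = i + 1" "k = j + 2"
      by blast
    then show ?thesis
    proof cases
      case 1
      with l X ranks show ?thesis by (simp add: simps)
    next
      case 2
      with l X ranks show ?thesis by (simp add: simps)
    next
      case 3
      with l X ranks show ?thesis by (simp add: simps)
    next
      case 4
      with c have c': "x = Vg i" "y = Eg (Suc i)" "z = Vg (Suc (Suc (Suc i)))" by simp_all
      \<comment> \<open>After \<open>M1\<close> and \<open>M2\<close> the sides differ in the order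
        of \<open>ee i\<close> and \<open>ee (i + 2)\<close> before \<open>ee (i + 1)\<close>, which
        \<open>M3\<close> repairs.\<close>
      from X show ?thesis
        by (simp add: c' M1[unfolded c'] M2[unfolded c'] M3[unfolded c'] lin P_gens_iff left_def rank_def algebra_simps)
    qed
  next
    fix i j k assume c: "x = Vg i" "y = Eg j" "z = Eg k"
    note simps = c M1[unfolded c] M2[unfolded c] M3[unfolded c] lin P_gens_iff left_def rank_def algebra_simps
    from l X ranks show ?thesis
      by (cases "j = i + 1") (simp_all add: simps)
  next
    fix i j k assume c: "x = Eg i" "y = Vg j" "z = Vg k"
    note simps = c M1[unfolded c] M2[unfolded c] M3[unfolded c] lin P_gens_iff left_def rank_def algebra_simps
    consider "j \<noteq> i + 2" "k \<noteq> j + 1" | "j \<noteq> i + 2" "k = j + 1" | "j = i + 2" "k \<noteq> j + 1" | "j = i + 2" "k = j + 1"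
      by blast
    then show ?thesis
    proof cases
      case 1
      with l X ranks show ?thesis by (simp add: simps)
    next
      case 2
      with l X ranks show ?thesis by (simp add: simps)
    next
      case 3
      with l X ranks show ?thesis by (simp add: simps)
    next
      case 4
      with c have c': "x = Eg i" "y = Vg (Suc (Suc i))" "z = Vg (Suc (Suc (Suc i)))" by simp_all
      from X show ?thesis
        by (simp add: c' M1[unfolded c'] M2[unfolded c'] M3[unfolded c'] lin P_gens_iff left_def rank_def algebra_simps)
    qed
  next
    fix i j k assume c: "x = Eg i" "y = Vg j" "z = Eg k"
    note simps = c M1[unfolded c] M2[unfolded c] M3[unfolded c] lin P_gens_iff left_def rank_def algebra_simps
    consider "j \<noteq> i + 2" "k \<noteq> j + 1" | "j \<noteq> i + 2" "k = j + 1" | "j = i + 2" "k \<noteq> j + 1" | "j = i + 2" "k = j + 1"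
      by blast
    then show ?thesis
    proof cases
      case 1
      with l X ranks show ?thesis by (simp add: simps)
    next
      case 2
      with l X ranks show ?thesis by (simp add: simps)
    next
      case 3
      with l X ranks show ?thesis by (simp add: simps)
    next
      case 4
      with c have c': "x = Eg i" "y = Vg (Suc (Suc i))" "z = Eg (Suc (Suc (Suc i)))" by simp_all
      from X show ?thesis
        by (simp add: c' M1[unfolded c'] M2[unfolded c'] M3[unfolded c'] lin P_gens_iff left_def rank_def algebra_simps)
    qed
  next
    fix i j k assume c: "x = Eg i" "y = Eg j" "z = Vg k"
    note simps = c M1[unfolded c] M2[unfolded c] M3[unfolded c] lin P_gens_iff left_def rank_def algebra_simps
    from l X ranks show ?thesis
      by (cases "k = j + 2") (simp_all add: simps)
  next
    fix i j k assume c: "x = Eg i" "y = Eg j" "z = Eg k"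
    note simps = c M1[unfolded c] M2[unfolded c] M3[unfolded c] lin P_gens_iff left_def rank_def algebra_simps
    show ?thesis by (simp add: c)
  qed
  have corr_xz: "corr x z = (0 :: (gen, 'f) ncpoly)"
    using l by (rule corr_between)
  have "G (P_rhs z y * var x) = G (var x * (var y * var z)) + G (corr x y * var z) + G (corr y z * var x)"
    using H2[of z x y] H1[of y x z] X l xz ranks corr_xz
    by (simp add: P_red_def P_rhs_def algebra_simps lin)
  moreover have "G (var z * P_rhs y x) = G (var x * (var y * var z)) + G (var x * corr y z) + G (var z * corr x y)"
    using H1[of z x y] H2[of z y x] X l xz ranks left_rank[OF xz] corr_xz
    by (simp add: P_red_def P_rhs_def algebra_simps lin)
  ultimately show ?thesis using key by (simp add: algebra_simps)
qed

lemma P_quadratic_rewriting: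
  "quadratic_rewriting (P_gens n) (P_rels n :: (gen, 'f::field) ncpoly set) rank (P_red n) P_rhs"
proof
  show "\<exists>c d. w = [c, d] \<and> c \<in> P_gens n \<and> d \<in> P_gens n \<and> rank c < rank a"
    if "P_red n a b" "w \<in> Poly_Mapping.keys (P_rhs a b :: (gen, 'f) ncpoly)" for a b w
  proof -
    have "w \<in> Poly_Mapping.keys (var b * var a :: (gen, 'f) ncpoly) \<or>
        w \<in> Poly_Mapping.keys (corr b a :: (gen, 'f) ncpoly)"
      using subsetD[OF keys_add that(2)[unfolded P_rhs_def]] by blast
    then show ?thesis
    proof
      assume "w \<in> Poly_Mapping.keys (var b * var a :: (gen, 'f) ncpoly)"
      with that(1) show ?thesis by (auto simp: var_mult_var P_red_def left_rank)
    qed (rule corr_keys[OF that(1)])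
  qed
  show "P_rels n \<subseteq> carrier (free_algebra (P_gens n) :: (gen, 'f) ncpoly ring)"
  proof
    fix r :: "(gen, 'f) ncpoly" assume "r \<in> P_rels n"
    then obtain a b where ab: "P_red n a b" and r: "r = var a * var b - P_rhs a b \<or> r = P_rhs a b - var a * var b"
      by (rule P_rels_cases)
    have "Poly_Mapping.keys (corr b a :: (gen, 'f) ncpoly) \<subseteq> lists (P_gens n)"
      using corr_keys[OF ab] by fastforce
    then have "Poly_Mapping.keys (P_rhs a b :: (gen, 'f) ncpoly) \<subseteq> lists (P_gens n)"
      unfolding P_rhs_def using ab by (intro keys_add_subset) (auto simp: var_mult_var P_red_def)
    moreover have "Poly_Mapping.keys (var a * var b :: (gen, 'f) ncpoly) \<subseteq> lists (P_gens n)"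
      using ab by (simp add: var_mult_var P_red_def)
    ultimately have "Poly_Mapping.keys r \<subseteq> lists (P_gens n)"
      using r keys_diff_subset by metis
    then show "r \<in> carrier (free_algebra (P_gens n))" by simp
  qed
  show "G r = 0" if G: "lin G" and red: "\<And>a b. P_red n a b \<Longrightarrow> G (var a * var b) = G (P_rhs a b)"
    and r: "r \<in> P_rels n" for G :: "(gen, 'f) ncpoly \<Rightarrow> (gen, 'f) ncpoly" and r
    using r red by (elim P_rels_cases) (auto simp: lin_diff[OF G])
  show "finite (P_gens n)" by (rule finite_P_gens)
qed (fact P_rule_in_P_rels P_overlap)+

text \<open>Normal words avoid the adjacent pairs of decreasing chains, so
  \<open>words_of_series\<close> inverts the series of the latter; reversal turns these into the
  increasing chains behind \<open>H_series\<close>.\<close>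

theorem hilbert_series_P:
  "hilbert_series (P_gens n) (P_rels n :: (gen, 'f::field) ncpoly set) = 1 / (H_series n oo (- fps_X))"
proof -
  interpret quadratic_rewriting "P_gens n" "P_rels n :: (gen, 'f) ncpoly set" rank "P_red n" P_rhs
    by (rule P_quadratic_rewriting)
  have "{w \<in> lists (P_gens n). length w = i \<and> normal w} = words_of (P_gens n) (\<lambda>a b. \<not> left b a) i" for i
    unfolding words_of_def normal_def
    by (intro Collect_cong conj_cong refl successively_cong) (auto simp: P_red_def)
  then show ?thesis
    using words_of_series[OF finite_P_gens, of n "\<lambda>a b. left b a"]
    by (simp add: hilbert_series_eq H_series_eq card_words_of_rev[of _ left])
qed

theorem mainTheorem3:
  fixes n :: nat
  assumes "n \<ge> 1"
  shows "hilbert_series (P_gens n)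
           (dual_relations (P_gens n) (ch_rels n :: (gen, 'f::field) ncpoly set)) = H_series n
       \<and> hilbert_series (P_gens n) (P_rels n :: (gen, 'f) ncpoly set)
           = 1 / (H_series n oo (- fps_X))"
  using hilbert_series_dual hilbert_series_P by blast

end
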